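(* Let $A\in M_n(\mathbb{Z})$ and let $\Sigma=\{F_m\}_{m=1}^\infty$ be a Følner sequence in $\mathbb{N}$. Then for a Borel probability measure $\mu$ on $\mathbb{T}^n$: (1) $\mu$ is an ergodic $\times A$-invariant measure if and only if $\lim_{m\to\infty}\frac{1}{|F_m|}\sum_{j\in F_m}\hat\mu(A^jk+l)=\hat\mu(k)\hat\mu(l)$ for all $k,l\in\mathbb{Z}^{n\times 1}$; (2) $\mu$ is a weakly mixing $\times A$-invariant measure if and only if $\lim_{m\to\infty}\frac{1}{|F_m|}\sum_{j\in F_m}|\hat\mu(A^jk+l)-\hat\mu(k)\hat\mu(l)|^2=0$ for all $k,l\in\mathbb{Z}^{n\times 1}$; (3) $\mu$ is a strongly mixing $\times A$-invariant measure if and only if $\lim_{j\to\infty}\hat\mu(A^jk+l)=\hat\mu(k)\hat\mu(l)$ for all $k,l\in\mathbb{Z}^{n\times 1}$.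
   Context: $\mathbb{N}=\{0,1,2,\dots\}$, $A^0=I_n$. Identify $\mathbb{T}^n$ with $\mathbb{R}^n/\mathbb{Z}^n$ via $(x_1,\dots,x_n)+\mathbb{Z}^n\mapsto(e^{2\pi i x_1},\dots,e^{2\pi i x_n})$; $T_A(x+\mathbb{Z}^n)=xA+\mathbb{Z}^n$ for row vectors $x\in\mathbb{R}^n$, and $\mu$ is $\times A$-invariant if it is $T_A$-invariant. For $k=(k_1,\dots,k_n)^T\in\mathbb{Z}^{n\times 1}$ and $z\in\mathbb{T}^n$, $z^k=z_1^{k_1}\cdots z_n^{k_n}$ and $\hat\mu(k)=\int_{\mathbb{T}^n}z^k\,d\mu(z)$. A $T$-invariant $\mu$ is ergodic if every Borel $F$ with $T^{-1}F=F$ has $\mu(F)\in\{0,1\}$; weakly mixing if $\mu\times\mu$ is ergodic for $T\times T$; strongly mixing if $\lim_{j\to\infty}\mu(T^{-j}F\cap G)=\mu(F)\mu(G)$ for all Borel $F,G$. A Følner sequence in $\mathbb{N}$ is a sequence $\{F_m\}$ of nonempty finite subsets of $\mathbb{N}$ with $\lim_{m\to\infty}|(F_m+m')\,\Delta\,F_m|/|F_m|=0$ for every $m'\in\mathbb{N}$. *)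

theory Defs
  imports "HOL-Probability.Probability"
begin

text \<open>The n-torus as the subset of complex^n whose coordinates have modulus 1
  (identified with R^n/Z^n via x + Z^n maps to (exp(2 pi i x_1),...)).\<close>
definition torus :: "(complex ^ 'n) set" where
  "torus = {z. \<forall>i. norm (z $ i) = 1}"

definition torus_prob :: "(complex ^ 'n) measure \<Rightarrow> bool" where
  "torus_prob \<mu> \<longleftrightarrow> prob_space \<mu> \<and> sets \<mu> = sets (restrict_space borel (torus :: (complex ^ 'n) set))"

primrec mat_pow :: "int ^ 'n ^ 'n \<Rightarrow> nat \<Rightarrow> int ^ 'n ^ 'n" where
  "mat_pow A 0 = mat 1"
| "mat_pow A (Suc j) = A ** mat_pow A j"

text \<open>T_A(x + Z^n) = xA + Z^n for a row vector x; multiplicatively, the j-th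
  coordinate of the image is prod_i z_i^(A_ij).\<close>
definition times_map :: "int ^ 'n ^ 'n \<Rightarrow> complex ^ 'n \<Rightarrow> complex ^ 'n" where
  "times_map A z = (\<chi> j. \<Prod>i\<in>UNIV. (z $ i) powi (A $ i $ j))"

definition charz :: "complex ^ 'n \<Rightarrow> int ^ 'n \<Rightarrow> complex" where
  "charz z k = (\<Prod>i\<in>UNIV. (z $ i) powi (k $ i))"

definition fourier_coeff :: "(complex ^ 'n) measure \<Rightarrow> int ^ 'n \<Rightarrow> complex" where
  "fourier_coeff \<mu> k = (\<integral>z. charz z k \<partial>\<mu>)"

definition invariant_measure :: "'a measure \<Rightarrow> ('a \<Rightarrow> 'a) \<Rightarrow> bool" where
  "invariant_measure M T \<longleftrightarrow> T \<in> measurable M M \<and> distr M M T = M"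

definition ergodic_measure :: "'a measure \<Rightarrow> ('a \<Rightarrow> 'a) \<Rightarrow> bool" where
  "ergodic_measure M T \<longleftrightarrow>
     (\<forall>F\<in>sets M. T -` F \<inter> space M = F \<longrightarrow> measure M F = 0 \<or> measure M F = 1)"

definition weakly_mixing :: "'a measure \<Rightarrow> ('a \<Rightarrow> 'a) \<Rightarrow> bool" where
  "weakly_mixing M T \<longleftrightarrow> ergodic_measure (M \<Otimes>\<^sub>M M) (\<lambda>(x, y). (T x, T y))"

definition strongly_mixing :: "'a measure \<Rightarrow> ('a \<Rightarrow> 'a) \<Rightarrow> bool" where
  "strongly_mixing M T \<longleftrightarrow>
     (\<forall>F\<in>sets M. \<forall>G\<in>sets M.
        (\<lambda>j. measure M ((T ^^ j) -` F \<inter> space M \<inter> G)) \<longlonglongrightarrow> measure M F * measure M G)"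

text \<open>A Folner sequence F_1, F_2, ... in N (the value at index 0 is irrelevant).\<close>
definition folner :: "(nat \<Rightarrow> nat set) \<Rightarrow> bool" where
  "folner F \<longleftrightarrow> (\<forall>m\<ge>1. F m \<noteq> {} \<and> finite (F m)) \<and>
     (\<forall>m'::nat. (\<lambda>m. real (card (((\<lambda>x. x + m') ` F m - F m) \<union> (F m - (\<lambda>x. x + m') ` F m)))
                     / real (card (F m))) \<longlonglongrightarrow> 0)"

end

theory Submission
  imports Defs
begin

text \<open>
  Write \<open>corr f q j\<close> for the integral of \<open>f \<circ> T ^^ j\<close> times \<open>q\<close>. Since \<open>z \<mapsto> z ^ k\<close> pulls back under
  \<open>T ^^ j\<close> to the character of \<open>A ^ j k\<close>, the numbers in the statement are the correlations of
  characters. If correlations of characters converge (along singletons or along averages), so do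
  those of all bounded measurable functions, because both sides are bilinear and stable under
  bounded pointwise limits, and the characters generate everything under these operations
  (Stone-Weierstrass for closed sets, then a monotone class argument). Indicators of invariant sets
  then give ergodicity, and indicators of arbitrary sets give mixing. Invariance comes from \<open>l = 0\<close>:
  a Folner average does not change when \<open>j\<close> is replaced by \<open>j + 1\<close>, so \<open>k\<close> and \<open>A k\<close> have the same
  Fourier coefficient.

  Conversely, ergodicity gives convergence of the averages by the mean ergodic theorem: some element
  of the convex hull of the orbit of a mean-zero \<open>f\<close> has small norm, and it differs from \<open>f\<close> by
  coboundaries, whose Folner averages vanish. Weak mixing is ergodicity of \<open>T \<times> T\<close>, whose
  correlations of tensor products are products of correlations of \<open>T\<close>.
\<close>

section \<open>Classes of bounded functions closed under bounded limits\<close>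

text \<open>The bound is required at every point of the space, not almost everywhere, so that null
  sets stay out of the closure arguments and composition with measurable maps preserves the
  class.\<close>

definition bfun :: "'a measure \<Rightarrow> ('a \<Rightarrow> complex) set" where
  "bfun M = {f \<in> borel_measurable M. \<exists>B. \<forall>x\<in>space M. cmod (f x) \<le> B}"

lemma bfunI: "f \<in> borel_measurable M \<Longrightarrow> (\<And>x. x \<in> space M \<Longrightarrow> cmod (f x) \<le> B) \<Longrightarrow> f \<in> bfun M"
  by (auto simp: bfun_def)

lemma bfunE:
  assumes "f \<in> bfun M"
  obtains B where "f \<in> borel_measurable M" "\<And>x. x \<in> space M \<Longrightarrow> cmod (f x) \<le> B" "B > 0"
proof -
  obtain B where "f \<in> borel_measurable M" "\<forall>x\<in>space M. cmod (f x) \<le> B"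
    using assms by (auto simp: bfun_def)
  then show ?thesis using that[of "max B 1"] by fastforce
qed

lemma bfun_measurable [measurable_dest]: "f \<in> bfun M \<Longrightarrow> f \<in> borel_measurable M"
  by (simp add: bfun_def)

lemma bfun_add [intro]:
  assumes "f \<in> bfun M" "g \<in> bfun M"
  shows "(\<lambda>x. f x + g x) \<in> bfun M"
proof -
  obtain B C where [measurable]: "f \<in> borel_measurable M" "g \<in> borel_measurable M" and
    "\<And>x. x \<in> space M \<Longrightarrow> cmod (f x) \<le> B" "\<And>x. x \<in> space M \<Longrightarrow> cmod (g x) \<le> C"
    using assms by (elim bfunE) blast
  then show ?thesis by (intro bfunI[where B="B+C"]) (auto intro: norm_triangle_mono)
qed

lemma bfun_mult [intro]:
  assumes "f \<in> bfun M" "g \<in> bfun M"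
  shows "(\<lambda>x. f x * g x) \<in> bfun M"
proof -
  obtain B C where [measurable]: "f \<in> borel_measurable M" "g \<in> borel_measurable M" and
    "\<And>x. x \<in> space M \<Longrightarrow> cmod (f x) \<le> B" "\<And>x. x \<in> space M \<Longrightarrow> cmod (g x) \<le> C" "B > 0"
    using assms by (elim bfunE) blast
  then show ?thesis by (intro bfunI[where B="B*C"]) (auto simp: norm_mult intro!: mult_mono)
qed

lemma bfun_const [intro]: "(\<lambda>x. c) \<in> bfun M"
  by (auto simp: bfun_def)

lemma bfun_scale [intro]: "f \<in> bfun M \<Longrightarrow> (\<lambda>x. c * f x) \<in> bfun M"
  by (intro bfun_mult bfun_const)

lemma bfun_diff [intro]:
  assumes "f \<in> bfun M" "g \<in> bfun M"
  shows "(\<lambda>x. f x - g x) \<in> bfun M"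
  using bfun_add[OF assms(1) bfun_scale[OF assms(2), of "-1"]] by simp

lemma bfun_indicator [intro]: "S \<in> sets M \<Longrightarrow> indicator S \<in> bfun M"
  by (intro bfunI[where B=1]) (auto simp: indicator_def)

lemma bfun_compose:
  assumes "f \<in> bfun N" "T \<in> measurable M N"
  shows "(\<lambda>x. f (T x)) \<in> bfun M"
proof -
  obtain B where [measurable]: "f \<in> borel_measurable N" and "\<And>x. x \<in> space N \<Longrightarrow> cmod (f x) \<le> B"
    using assms(1) by (elim bfunE) blast
  moreover note [measurable] = assms(2)
  ultimately show ?thesis by (intro bfunI[where B=B]) (use assms(2) in \<open>auto simp: measurable_def\<close>)
qed

lemma (in finite_measure) bfun_integrable [intro]:
  assumes "f \<in> bfun M" shows "integrable M f"
proof -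
  obtain B where [measurable]: "f \<in> borel_measurable M" and "\<And>x. x \<in> space M \<Longrightarrow> cmod (f x) \<le> B"
    using assms by (elim bfunE) blast
  then show ?thesis by (intro integrable_const_bound[where B=B]) auto
qed

text \<open>On a finite measure space the constant \<open>B\<close> is an integrable majorant. The
  third conclusion, convergence in \<open>L^1\<close>, later gives closeness of correlations
  uniformly in time.\<close>

lemma (in finite_measure) bfun_dominated_convergence:
  assumes u: "\<And>n. u n \<in> bfun M" and B: "\<And>n x. x \<in> space M \<Longrightarrow> cmod (u n x) \<le> B"
    and lim: "\<And>x. x \<in> space M \<Longrightarrow> (\<lambda>n. u n x) \<longlonglongrightarrow> f x"
  shows "f \<in> bfun M" "(\<lambda>n. \<integral>x. u n x \<partial>M) \<longlonglongrightarrow> (\<integral>x. f x \<partial>M)"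
    "(\<lambda>n. \<integral>x. cmod (u n x - f x) \<partial>M) \<longlonglongrightarrow> 0"
proof -
  have [measurable]: "u n \<in> borel_measurable M" for n using u by auto
  have [measurable]: "f \<in> borel_measurable M" using lim by (rule borel_measurable_LIMSEQ_metric[rotated]) auto
  have fB: "cmod (f x) \<le> B" if "x \<in> space M" for x
    by (rule Lim_bounded[OF tendsto_norm[OF lim[OF that]], of 0]) (use B that in auto)
  then show "f \<in> bfun M" by (intro bfunI[where B=B]) auto
  show "(\<lambda>n. \<integral>x. u n x \<partial>M) \<longlonglongrightarrow> (\<integral>x. f x \<partial>M)"
    by (rule integral_dominated_convergence[where w="\<lambda>_. B"]) (use lim B in auto)
  have "(\<lambda>n. \<integral>x. cmod (u n x - f x) \<partial>M) \<longlonglongrightarrow> (\<integral>x. 0 \<partial>M)"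
  proof (rule integral_dominated_convergence[where w="\<lambda>_. 2*B"])
    show "AE x in M. (\<lambda>n. cmod (u n x - f x)) \<longlonglongrightarrow> 0"
      using lim by (auto intro!: AE_I2 tendsto_norm_zero LIM_zero)
    show "AE x in M. norm (cmod (u n x - f x)) \<le> 2 * B" for n
    proof (rule AE_I2)
      fix x assume "x \<in> space M"
      then show "norm (cmod (u n x - f x)) \<le> 2 * B"
        using norm_triangle_ineq4[of "u n x" "f x"] fB[of x] B[of x n] by simp
    qed
  qed auto
  then show "(\<lambda>n. \<integral>x. cmod (u n x - f x) \<partial>M) \<longlonglongrightarrow> 0" by simp
qed

lemma (in finite_measure) integral_indicator_complex:
  assumes "S \<in> sets M" shows "(\<integral>x. indicator S x \<partial>M) = complex_of_real (measure M S)"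
proof -
  have "(\<integral>x. indicator S x \<partial>M) = (\<integral>x. complex_of_real (indicator S x) \<partial>M)"
    by (intro Bochner_Integration.integral_cong) (auto simp: indicator_def)
  then show ?thesis using assms by simp
qed

section \<open>Monotone class arguments\<close>

definition closed_class :: "'a set \<Rightarrow> ('a \<Rightarrow> complex) set \<Rightarrow> bool" where
  "closed_class X V \<longleftrightarrow>
     (\<forall>f\<in>V. \<forall>c. (\<lambda>x. c * f x) \<in> V) \<and> (\<forall>f\<in>V. \<forall>g\<in>V. (\<lambda>x. f x + g x) \<in> V) \<and>
     (\<forall>u f B. (\<forall>n::nat. u n \<in> V) \<longrightarrow> (\<forall>n. \<forall>x\<in>X. cmod (u n x) \<le> B) \<longrightarrow>
        (\<forall>x\<in>X. (\<lambda>n. u n x) \<longlonglongrightarrow> f x) \<longrightarrow> f \<in> V)"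

lemma closed_classI:
  assumes "\<And>f c. f \<in> V \<Longrightarrow> (\<lambda>x. c * f x) \<in> V"
    and "\<And>f g. f \<in> V \<Longrightarrow> g \<in> V \<Longrightarrow> (\<lambda>x. f x + g x) \<in> V"
    and "\<And>(u :: nat \<Rightarrow> _) f B. (\<And>n. u n \<in> V) \<Longrightarrow> (\<And>n x. x \<in> X \<Longrightarrow> cmod (u n x) \<le> B) \<Longrightarrow>
        (\<And>x. x \<in> X \<Longrightarrow> (\<lambda>n. u n x) \<longlonglongrightarrow> f x) \<Longrightarrow> f \<in> V"
  shows "closed_class X V"
  unfolding closed_class_def
proof (intro conjI allI impI ballI)
  fix u f B
  assume "\<forall>n::nat. u n \<in> V" "\<forall>n. \<forall>x\<in>X. cmod (u n x) \<le> B" "\<forall>x\<in>X. (\<lambda>n. u n x) \<longlonglongrightarrow> f x"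
  then show "f \<in> V" by (intro assms(3)[of u B f]) simp_all
qed (use assms(1,2) in auto)

lemma closed_class_scale: "closed_class X V \<Longrightarrow> f \<in> V \<Longrightarrow> (\<lambda>x. c * f x) \<in> V"
  by (auto simp: closed_class_def)

lemma closed_class_add: "closed_class X V \<Longrightarrow> f \<in> V \<Longrightarrow> g \<in> V \<Longrightarrow> (\<lambda>x. f x + g x) \<in> V"
  by (auto simp: closed_class_def)

lemma closed_class_diff: 
  assumes "closed_class X V" "f \<in> V" "g \<in> V" shows "(\<lambda>x. f x - g x) \<in> V"
  using closed_class_add[OF assms(1,2) closed_class_scale[OF assms(1,3), of "-1"]] by simp

lemma closed_class_lim:
  assumes "closed_class X V" "\<And>n::nat. u n \<in> V" "\<And>n x. x \<in> X \<Longrightarrow> cmod (u n x) \<le> B"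
    "\<And>x. x \<in> X \<Longrightarrow> (\<lambda>n. u n x) \<longlonglongrightarrow> f x"
  shows "f \<in> V"
  using assms unfolding closed_class_def by blast

text \<open>The constant sequence \<open>f\<close> converges to \<open>g\<close> on
  \<open>X\<close>, so for functions bounded on \<open>X\<close> the values outside \<open>X\<close>
  do not affect membership.\<close>

lemma closed_class_cong:
  assumes "closed_class X V" "f \<in> V" "\<And>x. x \<in> X \<Longrightarrow> cmod (f x) \<le> B" "\<And>x. x \<in> X \<Longrightarrow> f x = g x"
  shows "g \<in> V"
  by (rule closed_class_lim[OF assms(1), of "\<lambda>_. f" B g]) (use assms in auto)

text \<open>This works as an induction principle: a property that holds on \<open>E\<close> and is
  stable under linear combinations and bounded limits holds for all bounded measurable
  functions.\<close>

definition total_family :: "'a measure \<Rightarrow> ('a \<Rightarrow> complex) set \<Rightarrow> bool" where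
  "total_family M E \<longleftrightarrow> (\<forall>V. closed_class (space M) V \<longrightarrow> E \<subseteq> V \<longrightarrow> bfun M \<subseteq> V)"

lemma total_familyD:
  "total_family M E \<Longrightarrow> closed_class (space M) V \<Longrightarrow> (\<And>e. e \<in> E \<Longrightarrow> e \<in> V) \<Longrightarrow> f \<in> bfun M \<Longrightarrow> f \<in> V"
  by (auto simp: total_family_def)

text \<open>Nonnegative functions are reached from indicators by multiples, sums and increasing
  limits; real functions are differences of nonnegative ones, and complex functions are split into
  real and imaginary parts.\<close>

lemma total_family_indicators: "total_family M {indicator S |S. S \<in> sets M}"
  unfolding total_family_def
proof (intro allI impI subsetI)
  fix V and f :: "'a \<Rightarrow> complex"
  assume V: "closed_class (space M) V" and ind: "{indicator S |S. S \<in> sets M} \<subseteq> V" and f: "f \<in> bfun M"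
  \<comment> \<open>Boundedness is a premise inside the induction, because the induction rule
    supplies pieces without a bound; each case derives one for its pieces.\<close>
  have pos: "(\<exists>B. \<forall>x\<in>space M. u x \<le> B) \<longrightarrow> (\<lambda>x. complex_of_real (u x)) \<in> V"
    if "u \<in> borel_measurable M" "\<And>x. 0 \<le> u x" for u :: "'a \<Rightarrow> real"
    using that
  proof (induction rule: borel_measurable_induct_real)
    case (set S)
    have "(\<lambda>x. complex_of_real (indicator S x)) = indicator S"
      by (auto simp: indicator_def)
    then show ?case using ind set by auto
  next
    case (mult u c)
    show ?case
    \<comment> \<open>For \<open>c = 0\<close> a bound on \<open>c * u\<close> says nothing about
      \<open>u\<close>, so the zero function is obtained as the indicator of the empty set.\<close>
    proof (cases "c = 0")
      case True
      have "(indicator {} :: 'a \<Rightarrow> complex) \<in> V" using ind by blast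
      moreover have "(indicator {} :: 'a \<Rightarrow> complex) = (\<lambda>x. 0)" by (auto simp: indicator_def)
      ultimately show ?thesis using True by simp
    next
      case False
      then have "c > 0" using mult by simp
      show ?thesis
      proof
        assume "\<exists>B. \<forall>x\<in>space M. c * u x \<le> B"
        then obtain B where "\<forall>x\<in>space M. c * u x \<le> B" by blast
        then have "\<forall>x\<in>space M. u x \<le> B / c" using \<open>c > 0\<close> by (simp add: field_simps)
        then have "(\<lambda>x. complex_of_real (u x)) \<in> V" using mult by blast
        then show "(\<lambda>x. complex_of_real (c * u x)) \<in> V"
          using closed_class_scale[OF V] by simp
      qed
    qed
  next
    case (add u v)
    show ?case
    proof
      assume "\<exists>B. \<forall>x\<in>space M. v x + u x \<le> B"
      then obtain B where B: "\<forall>x\<in>space M. v x + u x \<le> B" by blast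
      have "\<forall>x\<in>space M. v x \<le> B" "\<forall>x\<in>space M. u x \<le> B"
        using B add.hyps(2,4) by (fastforce dest: bspec intro: order_trans[rotated])+
      then have "(\<lambda>x. complex_of_real (u x)) \<in> V" "(\<lambda>x. complex_of_real (v x)) \<in> V" using add by blast+
      then show "(\<lambda>x. complex_of_real (v x + u x)) \<in> V"
        using closed_class_add[OF V] by simp
    qed
  next
    case (seq U)
    show ?case
    proof
      assume "\<exists>B. \<forall>x\<in>space M. u x \<le> B"
      then obtain B where B: "\<forall>x\<in>space M. u x \<le> B" by blast
      have Ub: "U i x \<le> B" if "x \<in> space M" for i x
      proof -
        have "incseq (\<lambda>i. U i x)" using \<open>incseq U\<close> by (auto simp: incseq_def le_fun_def)
        then have "U i x \<le> u x" using seq.hyps(4)[OF that] by (rule incseq_le)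
        then show ?thesis using B that by force
      qed
      show "(\<lambda>x. complex_of_real (u x)) \<in> V"
      proof (rule closed_class_lim[OF V, of "\<lambda>i x. complex_of_real (U i x)" B])
        show "(\<lambda>x. complex_of_real (U n x)) \<in> V" for n using seq.IH Ub by blast
        show "cmod (complex_of_real (U n x)) \<le> B" if "x \<in> space M" for n x
          using Ub[OF that, of n] seq.hyps(2)[of n x] by simp
        show "(\<lambda>n. complex_of_real (U n x)) \<longlonglongrightarrow> complex_of_real (u x)" if "x \<in> space M" for x
          using seq.hyps(4)[OF that] by (rule tendsto_of_real)
      qed
    qed
  qed
  have re: "(\<lambda>x. complex_of_real (u x)) \<in> V"
    if [measurable]: "u \<in> borel_measurable M" and B: "\<And>x. x \<in> space M \<Longrightarrow> \<bar>u x\<bar> \<le> B" for u B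
  proof -
    have bd: "\<exists>B. \<forall>x\<in>space M. max 0 (u x) \<le> B" "\<exists>B. \<forall>x\<in>space M. max 0 (- u x) \<le> B"
      by (rule exI[of _ "max 0 B"], use B in force)+
    have "(\<lambda>x. complex_of_real (max 0 (u x))) \<in> V"
      by (intro pos[THEN mp] bd) auto
    moreover have "(\<lambda>x. complex_of_real (max 0 (- u x))) \<in> V"
      by (intro pos[THEN mp] bd) auto
    ultimately have "(\<lambda>x. complex_of_real (max 0 (u x)) - complex_of_real (max 0 (- u x))) \<in> V"
      by (rule closed_class_diff[OF V])
    also have "(\<lambda>x. complex_of_real (max 0 (u x)) - complex_of_real (max 0 (- u x))) = (\<lambda>x. complex_of_real (u x))"
      by (auto simp: max_def fun_eq_iff)
    finally show ?thesis .
  qed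
  obtain B where [measurable]: "f \<in> borel_measurable M" and B: "\<And>x. x \<in> space M \<Longrightarrow> cmod (f x) \<le> B"
    using f by (elim bfunE) blast
  have "(\<lambda>x. complex_of_real (Re (f x)) + \<i> * complex_of_real (Im (f x))) \<in> V"
    by (intro closed_class_add[OF V] closed_class_scale[OF V] re[where B=B])
       (auto intro: order_trans[OF abs_Re_le_cmod B] order_trans[OF abs_Im_le_cmod B])
  then show "f \<in> V" by (simp add: complex_eq[symmetric])
qed

text \<open>Dynkin's pi-lambda theorem: the sets whose indicator lies in \<open>V\<close> form a
  Dynkin system containing the intersection-stable generator \<open>G\<close>, hence all measurable
  sets.\<close>

lemma total_family_generator:
  assumes V: "closed_class (space M) V" and G: "Int_stable G" "G \<subseteq> Pow (space M)"
    "sets M = sigma_sets (space M) G"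
    and one: "(\<lambda>x. 1) \<in> V" and ind: "\<And>S. S \<in> G \<Longrightarrow> indicator S \<in> V"
  shows "bfun M \<subseteq> V"
proof -
  have zero: "(\<lambda>x. 0) \<in> V" using closed_class_scale[OF V one, of 0] by simp
  have "indicator S \<in> V" if "S \<in> sets M" for S
    using G(1,2) that[unfolded G(3)]
  proof (induction rule: sigma_sets_induct_disjoint)
    case (basic S) then show ?case by (rule ind)
  next
    case empty 
    have "(indicator {} :: 'a \<Rightarrow> complex) = (\<lambda>x. 0)" by (auto simp: indicator_def)
    then show ?case using zero by simp
  next
    case (compl S)
    have "(\<lambda>x. 1 - indicator S x) \<in> V" by (rule closed_class_diff[OF V one compl.IH])
    then show ?case
      \<comment> \<open>The two functions agree only on the space: outside it
        \<open>1 - indicator S\<close> is 1 and the indicator of the complement is 0.\<close>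
      by (rule closed_class_cong[OF V, where B=1]) (auto simp: indicator_def)
  next
    case (union S)
    have part: "(\<lambda>x. \<Sum>i<n. indicator (S i) x) \<in> V" for n
      by (induction n) (auto intro!: zero closed_class_add[OF V] union)
    \<comment> \<open>By disjointness a partial sum is the indicator of a finite union, which gives
      the common bound 1.\<close>
    have fin: "(\<Sum>i<n. indicator (S i) x :: complex) = indicator (\<Union>i<n. S i) x" for n x
      using union(1) by (subst indicator_UN_disjoint) (auto simp: disjoint_family_on_def)
    show ?case
    proof (rule closed_class_lim[OF V, of "\<lambda>n x. \<Sum>i<n. indicator (S i) x" 1])
      show "(\<lambda>x. \<Sum>i<n. indicator (S i) x) \<in> V" for n by (rule part)
      show "cmod (\<Sum>i<n. indicator (S i) x) \<le> 1" for n x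
        unfolding fin by (auto simp: indicator_def)
      show "(\<lambda>n. \<Sum>i<n. indicator (S i) x :: complex) \<longlonglongrightarrow> indicator (\<Union>i. S i) x" for x
        unfolding fin by (rule LIMSEQ_indicator_UN)
    qed
  qed
  then show ?thesis using total_family_indicators[of M] V unfolding total_family_def by blast
qed

section \<open>Averages and correlations\<close>

text \<open>The singletons \<open>{m}\<close> turn this into the sequence itself, so strong mixing
  fits the same framework. For an empty or infinite \<open>F m\<close> the value is 0.\<close>

definition ave :: "(nat \<Rightarrow> nat set) \<Rightarrow> (nat \<Rightarrow> 'a::real_normed_field) \<Rightarrow> nat \<Rightarrow> 'a" where
  "ave F b m = (\<Sum>j\<in>F m. b j) / of_nat (card (F m))"

lemma ave_add: "ave F (\<lambda>j. a j + b j) = (\<lambda>m. ave F a m + ave F b m)"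
  by (simp add: fun_eq_iff ave_def sum.distrib add_divide_distrib)

lemma ave_diff: "ave F (\<lambda>j. a j - b j) = (\<lambda>m. ave F a m - ave F b m)"
  by (simp add: fun_eq_iff ave_def sum_subtractf diff_divide_distrib)

lemma ave_scale: "ave F (\<lambda>j. c * b j) = (\<lambda>m. c * ave F b m)"
  by (simp add: fun_eq_iff ave_def sum_distrib_left)

lemma ave_const: "finite (F m) \<Longrightarrow> F m \<noteq> {} \<Longrightarrow> ave F (\<lambda>j. c) m = c"
  by (simp add: ave_def)

lemma norm_ave_le: "norm (ave F b m) \<le> ave F (\<lambda>j. norm (b j)) m"
  unfolding ave_def norm_divide norm_of_nat by (intro divide_right_mono sum_norm_le) auto

lemma ave_mono:
  fixes a b :: "nat \<Rightarrow> real"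
  shows "(\<And>j. a j \<le> b j) \<Longrightarrow> ave F a m \<le> ave F b m"
  unfolding ave_def by (intro divide_right_mono sum_mono) auto

text \<open>The bound covers every \<open>m\<close>, also those with \<open>F m\<close> empty or
  infinite, where the average is 0. This uniformity is what the exchange of limits requires.\<close>

lemma norm_ave_bound:
  assumes "\<And>j. norm (b j) \<le> K"
  shows "norm (ave F b m) \<le> K"
proof (cases "finite (F m) \<and> F m \<noteq> {}")
  case True
  have "norm (ave F b m) \<le> ave F (\<lambda>j. K) m" using norm_ave_le ave_mono[OF assms] by (rule order_trans)
  then show ?thesis using True by (simp add: ave_const)
next
  case False
  have "K \<ge> 0" using assms[of 0] norm_ge_zero order_trans by blast
  then show ?thesis using False by (auto simp: ave_def)
qed

lemma folner_eventually: "folner F \<Longrightarrow> eventually (\<lambda>m. finite (F m) \<and> F m \<noteq> {}) sequentially"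
  unfolding folner_def eventually_sequentially by blast

text \<open>The sums over \<open>F m\<close> and over its translate by 1 cancel on the intersection.
  At most \<open>K\<close> remains for each element of the symmetric difference, which is negligible
  against \<open>card (F m)\<close>.\<close>

lemma folner_shift:
  assumes F: "folner F" and b: "\<And>j. norm (b j) \<le> K"
  shows "(ave F (\<lambda>j. b j - b (Suc j))) \<longlonglongrightarrow> 0"
proof (rule Lim_null_comparison)
  let ?S = "\<lambda>m. (\<lambda>x. x + 1) ` F m"
  let ?D = "\<lambda>m. (?S m - F m) \<union> (F m - ?S m)"
  show "(\<lambda>m. K * (real (card (?D m)) / real (card (F m)))) \<longlonglongrightarrow> 0"
    using F unfolding folner_def by (intro tendsto_mult_right_zero) blast
  show "\<forall>\<^sub>F m in sequentially. norm (ave F (\<lambda>j. b j - b (Suc j)) m)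
      \<le> K * (real (card (?D m)) / real (card (F m)))"
    using folner_eventually[OF F]
  proof eventually_elim
    case (elim m)
    then have fin [simp]: "finite (F m)" by simp
    have "(\<Sum>j\<in>F m. b (Suc j)) = sum b (?S m)"
      by (subst sum.reindex) (auto simp: inj_on_def)
    then have "(\<Sum>j\<in>F m. b j - b (Suc j)) = sum b (F m) - sum b (?S m)" by (simp add: sum_subtractf)
    also have "\<dots> = sum b (F m - ?S m) - sum b (?S m - F m)"
      using sum.Int_Diff[of "F m" b "?S m"] sum.Int_Diff[of "?S m" b "F m"] by (simp add: Int_commute)
    finally have "norm (\<Sum>j\<in>F m. b j - b (Suc j)) \<le> norm (sum b (F m - ?S m)) + norm (sum b (?S m - F m))"
      by (simp add: norm_triangle_ineq4)
    also have "\<dots> \<le> real (card (F m - ?S m)) * K + real (card (?S m - F m)) * K"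
      by (intro add_mono sum_norm_bound b)
    also have "\<dots> = K * real (card (?D m))"
      by (subst card_Un_disjoint) (auto simp: algebra_simps)
    finally show ?case
      by (simp add: ave_def norm_divide divide_right_mono)
  qed
qed

text \<open>An epsilon/3 argument: \<open>a n m\<close> approximates \<open>b m\<close> uniformly in
  \<open>m\<close>, so the limits in \<open>n\<close> and \<open>m\<close> may be
  interchanged.\<close>

lemma tendsto_exchange:
  fixes a :: "nat \<Rightarrow> nat \<Rightarrow> complex"
  assumes a: "\<And>n. a n \<longlonglongrightarrow> l n" and e: "e \<longlonglongrightarrow> 0" and close: "\<And>n m. cmod (a n m - b m) \<le> e n"
    and l: "l \<longlonglongrightarrow> L"
  shows "b \<longlonglongrightarrow> L"
proof (rule LIMSEQ_I)
  fix r :: real assume "r > 0"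
  have "\<forall>\<^sub>F n in sequentially. e n < r / 3" "\<forall>\<^sub>F n in sequentially. cmod (l n - L) < r / 3"
    using order_tendstoD(2)[OF e, of "r/3"] tendstoD[OF l, of "r/3"] \<open>r > 0\<close> by (auto simp: dist_norm)
  then have "\<forall>\<^sub>F n in sequentially. e n < r / 3 \<and> cmod (l n - L) < r / 3" by (rule eventually_conj)
  then obtain n where n: "e n < r / 3" "cmod (l n - L) < r / 3"
    using eventually_happens'[OF sequentially_bot] by blast
  obtain N where N: "\<And>m. m \<ge> N \<Longrightarrow> cmod (a n m - l n) < r / 3"
    using LIMSEQ_D[OF a[of n], of "r/3"] \<open>r > 0\<close> by auto
  have "cmod (b m - L) < r" if "m \<ge> N" for m
  proof -
    have "b m - L = (a n m - l n) + (l n - L) - (a n m - b m)" by simp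
    then have "cmod (b m - L) \<le> cmod (a n m - l n) + cmod (l n - L) + cmod (a n m - b m)"
      by (metis norm_triangle_ineq norm_triangle_ineq4 add_right_mono order_trans)
    then show ?thesis using n N[OF that] close[of n m] by simp
  qed
  then show "\<exists>N. \<forall>m\<ge>N. cmod (b m - L) < r" by blast
qed

section \<open>Measure-preserving systems and their correlations\<close>

locale mp_system = prob_space M for M :: "'a measure" +
  fixes T :: "'a \<Rightarrow> 'a"
  assumes T [measurable]: "T \<in> measurable M M" and distr_T: "distr M M T = M"
begin

lemma integral_T:
  fixes f :: "'a \<Rightarrow> 'b::{banach, second_countable_topology}"
  shows "f \<in> borel_measurable M \<Longrightarrow> (\<integral>x. f (T x) \<partial>M) = (\<integral>x. f x \<partial>M)"
  using integral_distr[of T M M f] distr_T by simp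

lemma AE_T: "AE x in M. P x \<Longrightarrow> AE x in M. P (T x)"
  using AE_distrD[OF T, of P] distr_T by metis

lemma funpow_measurable [measurable]: "(T ^^ j) \<in> measurable M M"
  by (induction j) auto

lemma funpow_space: "x \<in> space M \<Longrightarrow> (T ^^ j) x \<in> space M"
  using measurable_space[OF funpow_measurable] .

lemma integral_funpow:
  fixes f :: "'a \<Rightarrow> 'b::{banach, second_countable_topology}"
  assumes [measurable]: "f \<in> borel_measurable M"
  shows "(\<integral>x. f ((T ^^ j) x) \<partial>M) = (\<integral>x. f x \<partial>M)"
proof (induction j)
  case (Suc j)
  have "(\<integral>x. f ((T ^^ Suc j) x) \<partial>M) = (\<integral>x. f ((T ^^ j) (T x)) \<partial>M)"
    by (simp add: funpow_swap1)
  also have "\<dots> = (\<integral>x. f ((T ^^ j) x) \<partial>M)" by (intro integral_T[of "\<lambda>x. f ((T ^^ j) x)"]) measurable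
  finally show ?case using Suc by simp
qed simp

definition corr :: "('a \<Rightarrow> complex) \<Rightarrow> ('a \<Rightarrow> complex) \<Rightarrow> nat \<Rightarrow> complex" where
  "corr f q j = (\<integral>x. f ((T ^^ j) x) * q x \<partial>M)"

lemma corr_integrable [intro]:
  "f \<in> bfun M \<Longrightarrow> q \<in> bfun M \<Longrightarrow> integrable M (\<lambda>x. f ((T ^^ j) x) * q x)"
  by (intro bfun_integrable bfun_mult bfun_compose[where T="T^^j"]) auto

lemma corr_add:
  assumes "f \<in> bfun M" "g \<in> bfun M" "q \<in> bfun M"
  shows "corr (\<lambda>x. f x + g x) q = (\<lambda>j. corr f q j + corr g q j)"
    "corr q (\<lambda>x. f x + g x) = (\<lambda>j. corr q f j + corr q g j)"
  unfolding corr_def fun_eq_iff using assms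
  by (auto simp: distrib_left distrib_right intro!: Bochner_Integration.integral_add)

lemma corr_diff:
  assumes "f \<in> bfun M" "g \<in> bfun M" "q \<in> bfun M"
  shows "corr (\<lambda>x. f x - g x) q = (\<lambda>j. corr f q j - corr g q j)"
    "corr q (\<lambda>x. f x - g x) = (\<lambda>j. corr q f j - corr q g j)"
  unfolding corr_def fun_eq_iff using assms
  by (auto simp: left_diff_distrib right_diff_distrib intro!: Bochner_Integration.integral_diff)

lemma corr_scale:
  "corr (\<lambda>x. c * f x) q = (\<lambda>j. c * corr f q j)" "corr f (\<lambda>x. c * q x) = (\<lambda>j. c * corr f q j)"
  unfolding corr_def fun_eq_iff by (simp_all add: mult.assoc mult.left_commute)

text \<open>The bounded factor \<open>q\<close> is pulled out and invariance removes the iterate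
  from the integral of \<open>cmod (f x)\<close>, so the bound is the same for all
  \<open>j\<close>.\<close>

lemma corr_bound:
  assumes f: "f \<in> bfun M" and q: "q \<in> bfun M" and B: "\<And>x. x \<in> space M \<Longrightarrow> cmod (q x) \<le> B"
  shows "cmod (corr f q j) \<le> B * (\<integral>x. cmod (f x) \<partial>M)"
proof -
  have [measurable]: "f \<in> borel_measurable M" using f by simp
  have fj: "(\<lambda>x. f ((T ^^ j) x)) \<in> bfun M" by (rule bfun_compose[where T="T^^j", OF f]) auto
  have "cmod (corr f q j) \<le> (\<integral>x. cmod (f ((T ^^ j) x) * q x) \<partial>M)"
    unfolding corr_def by (rule integral_norm_bound)
  also have "\<dots> \<le> (\<integral>x. B * cmod (f ((T ^^ j) x)) \<partial>M)"
  proof (rule integral_mono)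
    show "integrable M (\<lambda>x. cmod (f ((T ^^ j) x) * q x))" using f q by auto
    show "integrable M (\<lambda>x. B * cmod (f ((T ^^ j) x)))"
      by (intro integrable_mult_right integrable_norm bfun_integrable fj)
    show "cmod (f ((T ^^ j) x) * q x) \<le> B * cmod (f ((T ^^ j) x))" if "x \<in> space M" for x
      using B[OF that] by (simp add: norm_mult mult.commute mult_right_mono)
  qed
  also have "\<dots> = B * (\<integral>x. cmod (f x) \<partial>M)"
    using integral_funpow[of "\<lambda>x. cmod (f x)" j] by simp
  finally show ?thesis .
qed

text \<open>Here the factor composed with \<open>T ^^ j\<close> is the bounded one; orbits stay in
  the space, so \<open>B\<close> still applies.\<close>

lemma corr_bound':
  assumes f: "f \<in> bfun M" and q: "q \<in> bfun M" and B: "\<And>x. x \<in> space M \<Longrightarrow> cmod (f x) \<le> B"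
  shows "cmod (corr f q j) \<le> B * (\<integral>x. cmod (q x) \<partial>M)"
proof -
  have "cmod (corr f q j) \<le> (\<integral>x. cmod (f ((T ^^ j) x) * q x) \<partial>M)"
    unfolding corr_def by (rule integral_norm_bound)
  also have "\<dots> \<le> (\<integral>x. B * cmod (q x) \<partial>M)"
  proof (rule integral_mono)
    show "integrable M (\<lambda>x. cmod (f ((T ^^ j) x) * q x))" using f q by auto
    show "integrable M (\<lambda>x. B * cmod (q x))"
      by (intro integrable_mult_right integrable_norm bfun_integrable q)
    show "cmod (f ((T ^^ j) x) * q x) \<le> B * cmod (q x)" if "x \<in> space M" for x
      using B[OF funpow_space[OF that]] by (simp add: norm_mult mult_right_mono)
  qed
  finally show ?thesis by simp
qed

definition mixes :: "(nat \<Rightarrow> nat set) \<Rightarrow> ('a \<Rightarrow> complex) \<Rightarrow> ('a \<Rightarrow> complex) \<Rightarrow> bool" where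
  "mixes F f q \<longleftrightarrow> ave F (corr f q) \<longlonglongrightarrow> (\<integral>x. f x \<partial>M) * (\<integral>x. q x \<partial>M)"

text \<open>Functions that are close in \<open>L\<^sup>1\<close> have uniformly close correlation sequences against a
  bounded function, so the limit along \<open>F\<close> and the bounded pointwise limit may be exchanged.\<close>
lemma closed_class_mixes_left:
  assumes q: "q \<in> bfun M"
  shows "closed_class (space M) {f \<in> bfun M. mixes F f q}"
proof -
  obtain K where K: "\<And>x. x \<in> space M \<Longrightarrow> cmod (q x) \<le> K" using q by (elim bfunE) blast
  have scale: "mixes F (\<lambda>x. c * f x) q" if "mixes F f q" for f c
    using tendsto_mult_left[OF that[unfolded mixes_def], of c]
    by (simp add: mixes_def corr_scale ave_scale mult.assoc)
  have add: "mixes F (\<lambda>x. f x + g x) q" if "f \<in> bfun M" "g \<in> bfun M" "mixes F f q" "mixes F g q" for f g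
    using tendsto_add[OF that(3)[unfolded mixes_def] that(4)[unfolded mixes_def]] that(1,2) q
    by (simp add: mixes_def corr_add ave_add bfun_integrable distrib_right)
  have lim: "f \<in> bfun M \<and> mixes F f q"
    if u: "\<And>n::nat. u n \<in> bfun M" "\<And>n. mixes F (u n) q" and B: "\<And>n x. x \<in> space M \<Longrightarrow> cmod (u n x) \<le> B"
      and lim: "\<And>x. x \<in> space M \<Longrightarrow> (\<lambda>n. u n x) \<longlonglongrightarrow> f x" for u f B
  proof
    have D: "f \<in> bfun M" "(\<lambda>n. \<integral>x. u n x \<partial>M) \<longlonglongrightarrow> (\<integral>x. f x \<partial>M)"
      "(\<lambda>n. \<integral>x. cmod (u n x - f x) \<partial>M) \<longlonglongrightarrow> 0"
      using bfun_dominated_convergence[of u B f] u(1) B lim by blast+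
    show "f \<in> bfun M" by (fact D(1))
    have "ave F (corr f q) \<longlonglongrightarrow> (\<integral>x. f x \<partial>M) * (\<integral>x. q x \<partial>M)"
    proof (rule tendsto_exchange)
      show "ave F (corr (u n) q) \<longlonglongrightarrow> (\<integral>x. u n x \<partial>M) * (\<integral>x. q x \<partial>M)" for n
        using u(2) by (simp add: mixes_def)
      show "(\<lambda>n. (\<integral>x. u n x \<partial>M) * (\<integral>x. q x \<partial>M)) \<longlonglongrightarrow> (\<integral>x. f x \<partial>M) * (\<integral>x. q x \<partial>M)"
        by (intro tendsto_intros D(2))
      show "(\<lambda>n. K * (\<integral>x. cmod (u n x - f x) \<partial>M)) \<longlonglongrightarrow> 0"
        by (intro tendsto_mult_right_zero D(3))
      show "cmod (ave F (corr (u n) q) m - ave F (corr f q) m) \<le> K * (\<integral>x. cmod (u n x - f x) \<partial>M)" for n m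
        unfolding fun_cong[OF ave_diff, symmetric] fun_cong[OF corr_diff(1)[OF u(1) D(1) q], symmetric]
        by (intro norm_ave_bound corr_bound bfun_diff u(1) D(1) q K)
    qed
    then show "mixes F f q" by (simp add: mixes_def)
  qed
  show ?thesis
  proof (rule closed_classI, goal_cases)
    case (3 u f B)
    then show ?case using lim[of u B f] by simp
  qed (use scale add in auto)
qed

text \<open>The counterpart in the second argument: the \<open>L^1\<close> error now sits in the
  factor that is not iterated, so \<open>corr_bound'\<close> takes the place of
  \<open>corr_bound\<close>.\<close>

lemma closed_class_mixes_right:
  assumes q: "q \<in> bfun M"
  shows "closed_class (space M) {f \<in> bfun M. mixes F q f}"
proof -
  obtain K where K: "\<And>x. x \<in> space M \<Longrightarrow> cmod (q x) \<le> K" using q by (elim bfunE) blast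
  have scale: "mixes F q (\<lambda>x. c * f x)" if "mixes F q f" for f c
    using tendsto_mult_left[OF that[unfolded mixes_def], of c]
    by (simp add: mixes_def corr_scale ave_scale mult.left_commute)
  have add: "mixes F q (\<lambda>x. f x + g x)" if "f \<in> bfun M" "g \<in> bfun M" "mixes F q f" "mixes F q g" for f g
    using tendsto_add[OF that(3)[unfolded mixes_def] that(4)[unfolded mixes_def]] that(1,2) q
    by (simp add: mixes_def corr_add ave_add bfun_integrable distrib_left)
  have lim: "f \<in> bfun M \<and> mixes F q f"
    if u: "\<And>n::nat. u n \<in> bfun M" "\<And>n. mixes F q (u n)" and B: "\<And>n x. x \<in> space M \<Longrightarrow> cmod (u n x) \<le> B"
      and lim: "\<And>x. x \<in> space M \<Longrightarrow> (\<lambda>n. u n x) \<longlonglongrightarrow> f x" for u f B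
  proof
    have D: "f \<in> bfun M" "(\<lambda>n. \<integral>x. u n x \<partial>M) \<longlonglongrightarrow> (\<integral>x. f x \<partial>M)"
      "(\<lambda>n. \<integral>x. cmod (u n x - f x) \<partial>M) \<longlonglongrightarrow> 0"
      using bfun_dominated_convergence[of u B f] u(1) B lim by blast+
    show "f \<in> bfun M" by (fact D(1))
    have "ave F (corr q f) \<longlonglongrightarrow> (\<integral>x. q x \<partial>M) * (\<integral>x. f x \<partial>M)"
    proof (rule tendsto_exchange)
      show "ave F (corr q (u n)) \<longlonglongrightarrow> (\<integral>x. q x \<partial>M) * (\<integral>x. u n x \<partial>M)" for n
        using u(2) by (simp add: mixes_def)
      show "(\<lambda>n. (\<integral>x. q x \<partial>M) * (\<integral>x. u n x \<partial>M)) \<longlonglongrightarrow> (\<integral>x. q x \<partial>M) * (\<integral>x. f x \<partial>M)"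
        by (intro tendsto_intros D(2))
      show "(\<lambda>n. K * (\<integral>x. cmod (u n x - f x) \<partial>M)) \<longlonglongrightarrow> 0"
        by (intro tendsto_mult_right_zero D(3))
      show "cmod (ave F (corr q (u n)) m - ave F (corr q f) m) \<le> K * (\<integral>x. cmod (u n x - f x) \<partial>M)" for n m
        unfolding fun_cong[OF ave_diff, symmetric] fun_cong[OF corr_diff(2)[OF u(1) D(1) q], symmetric]
        by (intro norm_ave_bound corr_bound' bfun_diff u(1) D(1) q K)
    qed
    then show "mixes F q f" by (simp add: mixes_def)
  qed
  show ?thesis
  proof (rule closed_classI, goal_cases)
    case (3 u f B)
    then show ?case using lim[of u B f] by simp
  qed (use scale add in auto)
qed

text \<open>One argument is extended at a time: first the left one against members of
  \<open>E\<close>, then the right one against an arbitrary bounded left one.\<close>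

lemma mixes_total:
  assumes tot: "total_family M E" and E: "E \<subseteq> bfun M"
    and mix: "\<And>e e'. e \<in> E \<Longrightarrow> e' \<in> E \<Longrightarrow> mixes F e e'"
    and f: "f \<in> bfun M" and q: "q \<in> bfun M"
  shows "mixes F f q"
proof -
  have "e' \<in> E \<Longrightarrow> f \<in> {f \<in> bfun M. mixes F f e'}" for e'
    using E mix by (intro total_familyD[OF tot closed_class_mixes_left _ f]) auto
  then have "q \<in> {q \<in> bfun M. mixes F f q}"
    using E by (intro total_familyD[OF tot closed_class_mixes_right[OF f] _ q]) auto
  then show ?thesis by simp
qed

text \<open>The correlation of the indicator of an invariant set with itself is constantly
  \<open>measure M S\<close>, so mixing makes this number equal to its own square.\<close>

lemma mixes_imp_ergodic:
  assumes ev: "eventually (\<lambda>m. finite (F m) \<and> F m \<noteq> {}) sequentially"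
    and mix: "\<And>f q. f \<in> bfun M \<Longrightarrow> q \<in> bfun M \<Longrightarrow> mixes F f q"
  shows "ergodic_measure M T"
  unfolding ergodic_measure_def
proof (intro ballI impI)
  fix S assume S [measurable]: "S \<in> sets M" and inv: "T -` S \<inter> space M = S"
  have iter: "(T ^^ j) x \<in> S \<longleftrightarrow> x \<in> S" if "x \<in> space M" for j x
  proof (induction j)
    case (Suc j)
    have "T y \<in> S \<longleftrightarrow> y \<in> S" if "y \<in> space M" for y using inv that by blast
    from this[OF funpow_space[OF that]] Suc show ?case by simp
  qed simp
  have "corr (indicator S) (indicator S) = (\<lambda>j. complex_of_real (measure M S))"
  proof
    fix j
    have "corr (indicator S) (indicator S) j = (\<integral>x. indicator S x \<partial>M)"
      unfolding corr_def by (intro Bochner_Integration.integral_cong) (auto simp: indicator_def iter)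
    then show "corr (indicator S) (indicator S) j = complex_of_real (measure M S)"
      by (simp only: integral_indicator_complex[OF S])
  qed
  moreover have "mixes F (indicator S) (indicator S)" by (intro mix bfun_indicator S)
  ultimately have "ave F (\<lambda>j. complex_of_real (measure M S)) \<longlonglongrightarrow> complex_of_real (measure M S) * complex_of_real (measure M S)"
    by (simp only: mixes_def integral_indicator_complex[OF S])
  moreover have "ave F (\<lambda>j. complex_of_real (measure M S)) \<longlonglongrightarrow> measure M S"
  proof (rule tendsto_eventually)
    show "\<forall>\<^sub>F m in sequentially. ave F (\<lambda>j. complex_of_real (measure M S)) m = measure M S"
      using ev by eventually_elim (rule ave_const; simp)
  qed
  ultimately have "complex_of_real (measure M S) * complex_of_real (measure M S) = complex_of_real (measure M S)"
    by (rule LIMSEQ_unique)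
  then show "measure M S = 0 \<or> measure M S = 1" by simp
qed

end

section \<open>The mean ergodic theorem\<close>

context mp_system
begin

text \<open>For \<open>c\<close> below the mean, the set where \<open>h\<close> is at most
  \<open>c\<close> is invariant up to a null set; full measure would push the mean down to
  \<open>c\<close>, so it is null. Hence \<open>h\<close> is almost everywhere at least its mean,
  which forces equality.\<close>

lemma ergodic_invariant_const:
  fixes h :: "'a \<Rightarrow> real"
  assumes erg: "ergodic_measure M T" and h: "integrable M h" and inv: "AE x in M. h (T x) = h x"
  shows "AE x in M. h x = (\<integral>x. h x \<partial>M)"
proof -
  have [measurable]: "h \<in> borel_measurable M" using h by simp
  have "AE x in M. h ((T ^^ j) x) = h x" for j
  proof (induction j)
    case (Suc j)
    show ?case using AE_T[OF Suc] inv by eventually_elim (simp add: funpow_swap1)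
  qed simp
  then have iter: "AE x in M. \<forall>j. h ((T ^^ j) x) = h x" by (simp add: AE_all_countable)
  have gt: "AE x in M. c < h x" if c: "c < (\<integral>x. h x \<partial>M)" for c
  proof -
    \<comment> \<open>\<open>h\<close> is only almost everywhere invariant; the set where \<open>h \<circ> T ^^ j \<le> c\<close> holds for all
      large \<open>j\<close> is strictly invariant.\<close>
    define S where "S = {x \<in> space M. \<exists>n. \<forall>j\<ge>n. h ((T ^^ j) x) \<le> c}"
    have S [measurable]: "S \<in> sets M" unfolding S_def by measurable
    \<comment> \<open>Passing from \<open>x\<close> to \<open>T x\<close> drops the first term of
      the orbit, which an eventual condition does not notice.\<close>
    have "T x \<in> S \<longleftrightarrow> x \<in> S" if x: "x \<in> space M" for x
      using eventually_sequentially_Suc[of "\<lambda>j. h ((T ^^ j) x) \<le> c"] x measurable_space[OF T x]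
      by (simp add: S_def eventually_sequentially funpow_swap1)
    then have "T -` S \<inter> space M = S" by (auto simp: S_def)
    then have "measure M S = 0 \<or> measure M S = 1"
      using erg S unfolding ergodic_measure_def by blast
    then show ?thesis
    proof
      assume "measure M S = 0"
      then have "AE x in M. x \<notin> S" by (simp add: prob_eq_0)
      with iter AE_space show ?thesis by eventually_elim (auto simp: S_def not_le)
    next
      assume "measure M S = 1"
      then have "AE x in M. x \<in> S" by (simp add: prob_eq_1)
      with iter have "AE x in M. h x \<le> c"
        by eventually_elim (auto simp: S_def)
      then have "(\<integral>x. h x \<partial>M) \<le> (\<integral>x. c \<partial>M)" using h by (intro integral_mono_AE) auto
      then show ?thesis using c by (simp add: prob_space)
    qed
  qed
  let ?a = "\<integral>x. h x \<partial>M"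
  have "AE x in M. \<forall>n. ?a - 1 / real (Suc n) < h x"
    unfolding AE_all_countable by (intro allI gt) simp
  then have "AE x in M. - h x \<le> - ?a"
  proof eventually_elim
    case (elim x)
    show ?case
    proof (rule ccontr)
      assume "\<not> - h x \<le> - ?a"
      then have "?a - h x > 0" by simp
      then obtain n where "1 / real (Suc n) < ?a - h x" using nat_approx_posE by blast
      then show False using elim[rule_format, of n] by simp
    qed
  qed
  \<comment> \<open>An integrable function bounded above by its own mean on a probability space
    equals it almost everywhere; the sign turns the lower bound for \<open>h\<close> into an upper
    one.\<close>
  then have "AE x in M. - h x = - ?a"
    by (rule integral_bounded_eq_bound_then_AE) (use h in \<open>auto simp: prob_space\<close>)
  then show ?thesis by simp
qed

inductive_set orbit_hull :: "('a \<Rightarrow> complex) \<Rightarrow> ('a \<Rightarrow> complex) set" for f where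
  base: "f \<in> orbit_hull f"
| shift: "g \<in> orbit_hull f \<Longrightarrow> (\<lambda>x. g (T x)) \<in> orbit_hull f"
| mid: "g \<in> orbit_hull f \<Longrightarrow> h \<in> orbit_hull f \<Longrightarrow> (\<lambda>x. 1/2 * (g x + h x)) \<in> orbit_hull f"

lemma orbit_hull_bfun: "f \<in> bfun M \<Longrightarrow> g \<in> orbit_hull f \<Longrightarrow> g \<in> bfun M"
  by (erule orbit_hull.induct) (assumption | intro bfun_compose[OF _ T] bfun_scale bfun_add)+

lemma orbit_hull_bound:
  assumes "\<And>x. x \<in> space M \<Longrightarrow> cmod (f x) \<le> B" "g \<in> orbit_hull f" "x \<in> space M"
  shows "cmod (g x) \<le> B"
  using assms(2,3)
proof (induction arbitrary: x)
  case (shift g)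
  then show ?case using measurable_space[OF T] by blast
next
  case (mid g h)
  have "cmod (g x + h x) \<le> B + B" using mid by (intro norm_triangle_mono) auto
  then show ?case by (simp add: norm_mult)
qed (use assms(1) in auto)

lemma orbit_hull_integral:
  assumes "f \<in> bfun M" "g \<in> orbit_hull f"
  shows "(\<integral>x. g x \<partial>M) = (\<integral>x. f x \<partial>M)"
  using assms(2)
proof induction
  case (shift g)
  then show ?case using integral_T[of g] orbit_hull_bfun[OF assms(1)] by auto
next
  case (mid g h)
  then show ?case using orbit_hull_bfun[OF assms(1)]
    by (subst integral_mult_right_zero, subst Bochner_Integration.integral_add) (auto simp: bfun_integrable)
qed simp

text \<open>Composition with \<open>T\<close> advances the correlation sequence by one index, a
  change that Folner averages remove in the limit; midpoints follow by linearity.\<close>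

lemma orbit_hull_folner:
  assumes F: "folner F" and f: "f \<in> bfun M" and q: "q \<in> bfun M" and g: "g \<in> orbit_hull f"
  shows "ave F (\<lambda>j. corr f q j - corr g q j) \<longlonglongrightarrow> 0"
  using g
proof induction
  case base
  then show ?case by (simp add: ave_def)
next
  case (shift g)
  have gb: "g \<in> bfun M" using orbit_hull_bfun[OF f] shift by blast
  obtain B where B: "\<And>x. x \<in> space M \<Longrightarrow> cmod (q x) \<le> B" using q by (elim bfunE) blast
  have "corr (\<lambda>x. g (T x)) q j = corr g q (Suc j)" for j
    unfolding corr_def by (simp add: funpow_swap1)
  then have eq: "(\<lambda>j. corr f q j - corr (\<lambda>x. g (T x)) q j)
    = (\<lambda>j. (corr f q j - corr g q j) + (corr g q j - corr g q (Suc j)))" by auto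
  have "ave F (\<lambda>j. corr g q j - corr g q (Suc j)) \<longlonglongrightarrow> 0"
    by (rule folner_shift[OF F corr_bound[OF gb q B]])
  from tendsto_add[OF shift.IH this] show ?case unfolding eq ave_add by simp
next
  case (mid g h)
  have b: "g \<in> bfun M" "h \<in> bfun M" using orbit_hull_bfun[OF f] mid by blast+
  have eq: "(\<lambda>j. corr f q j - corr (\<lambda>x. 1/2 * (g x + h x)) q j) =
     (\<lambda>j. 1/2 * ((corr f q j - corr g q j) + (corr f q j - corr h q j)))"
    unfolding corr_scale corr_add[OF b q] by (auto simp: field_simps)
  from tendsto_mult_left[OF tendsto_add[OF mid.IH], of "1/2"] show ?case
    unfolding eq ave_scale ave_add by simp
qed

lemma bfun_norm_power_integrable: "f \<in> bfun M \<Longrightarrow> integrable M (\<lambda>x. (cmod (f x))\<^sup>2)"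
proof -
  assume f: "f \<in> bfun M"
  then obtain B where [measurable]: "f \<in> borel_measurable M" and "\<And>x. x \<in> space M \<Longrightarrow> cmod (f x) \<le> B"
    by (elim bfunE) blast
  then show ?thesis
    by (intro integrable_const_bound[where B="B\<^sup>2"]) (auto intro!: AE_I2 power_mono)
qed

text \<open>This is nonnegativity of the variance of \<open>cmod (f x)\<close>.\<close>

lemma L1_le_L2:
  assumes "f \<in> bfun M"
  shows "(\<integral>x. cmod (f x) \<partial>M)\<^sup>2 \<le> (\<integral>x. (cmod (f x))\<^sup>2 \<partial>M)"
  using variance_eq[of "\<lambda>x. cmod (f x)"] variance_positive[of "\<lambda>x. cmod (f x)"]
    bfun_norm_power_integrable[OF assms] integrable_norm[OF bfun_integrable[OF assms]] by simp

text \<open>For two members of the hull the midpoint is a member as well, so this identity forces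
  near-minimisers of the \<open>L^2\<close> norm to be close to each other.\<close>

lemma parallelogram_integral:
  assumes g: "g \<in> bfun M" and h: "h \<in> bfun M"
  shows "(\<integral>x. (cmod (g x - h x))\<^sup>2 \<partial>M) + 4 * (\<integral>x. (cmod (1/2 * (g x + h x)))\<^sup>2 \<partial>M)
    = 2 * (\<integral>x. (cmod (g x))\<^sup>2 \<partial>M) + 2 * (\<integral>x. (cmod (h x))\<^sup>2 \<partial>M)"
proof -
  have "(cmod (a - b))\<^sup>2 + 4 * (cmod (1/2 * (a + b)))\<^sup>2 = 2 * (cmod a)\<^sup>2 + 2 * (cmod b)\<^sup>2" for a b :: complex
    unfolding cmod_power2 by (simp add: power2_eq_square field_simps)
  then have "(\<integral>x. (cmod (g x - h x))\<^sup>2 + 4 * (cmod (1/2 * (g x + h x)))\<^sup>2 \<partial>M)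
    = (\<integral>x. 2 * (cmod (g x))\<^sup>2 + 2 * (cmod (h x))\<^sup>2 \<partial>M)"
    by (intro Bochner_Integration.integral_cong) auto
  moreover have "integrable M (\<lambda>x. (cmod (g x - h x))\<^sup>2)" "integrable M (\<lambda>x. (cmod (1/2 * (g x + h x)))\<^sup>2)"
    by (intro bfun_norm_power_integrable bfun_diff bfun_scale bfun_add g h)+
  ultimately show ?thesis
    using bfun_norm_power_integrable[OF g] bfun_norm_power_integrable[OF h] by simp
qed

text \<open>An invariant element of minimal norm in the closed convex hull of the orbit of \<open>f\<close>
  (F. Riesz). Since the hull is uniformly bounded, an almost everywhere convergent subsequence and
  dominated convergence replace completeness of \<open>L\<^sup>2\<close>.\<close>
lemma orbit_hull_small:
  assumes erg: "ergodic_measure M T" and f: "f \<in> bfun M" and f0: "(\<integral>x. f x \<partial>M) = 0" and "\<epsilon> > 0"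
  shows "\<exists>g\<in>orbit_hull f. (\<integral>x. cmod (g x) \<partial>M) < \<epsilon>"
proof -
  obtain B where B: "\<And>x. x \<in> space M \<Longrightarrow> cmod (f x) \<le> B" using f by (elim bfunE) blast
  define I where "I g = (\<integral>x. (cmod (g x))\<^sup>2 \<partial>M)" for g :: "'a \<Rightarrow> complex"
  define d where "d = Inf (I ` orbit_hull f)"
  have bdd: "bdd_below (I ` orbit_hull f)" by (rule bdd_belowI[of _ 0]) (auto simp: I_def)
  have dle: "d \<le> I g" if "g \<in> orbit_hull f" for g
    unfolding d_def using that bdd by (intro cInf_lower) auto
  have "\<exists>g\<in>orbit_hull f. I g < d + 1 / real (Suc n)" for n
    using cInf_lessD[of "I ` orbit_hull f" "d + 1 / real (Suc n)"] orbit_hull.base[of f] by (auto simp: d_def)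
  then obtain u where u: "\<And>n. u n \<in> orbit_hull f" "\<And>n. I (u n) < d + 1 / real (Suc n)" by metis
  \<comment> \<open>The midpoint of \<open>g\<close> and \<open>h\<close> has squared norm at least
    \<open>d\<close>; the parallelogram law turns this into a bound on their distance.\<close>
  have L1: "(\<integral>x. cmod (g x - h x) \<partial>M)\<^sup>2 \<le> 2 * (I g - d) + 2 * (I h - d)"
    if "g \<in> orbit_hull f" "h \<in> orbit_hull f" for g h
  proof -
    have b: "g \<in> bfun M" "h \<in> bfun M" using orbit_hull_bfun[OF f] that by auto
    show ?thesis
      using L1_le_L2[OF bfun_diff[OF b]] parallelogram_integral[OF b] dle[OF orbit_hull.mid[OF that]]
      unfolding I_def distrib_left right_diff_distrib by argo
  qed
  have [simp, intro]: "integrable M (u n)" for n using orbit_hull_bfun[OF f u(1)] by (rule bfun_integrable)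
  have [measurable]: "u n \<in> borel_measurable M" for n by (rule borel_measurable_integrable) simp
  have cauchy: "\<exists>N. \<forall>i\<ge>N. \<forall>j\<ge>N. (\<integral>x. norm (u i x - u j x) \<partial>M) < e" if "e > 0" for e
  proof -
    obtain N where N: "1 / real (Suc N) < e\<^sup>2 / 4" using nat_approx_posE[of "e\<^sup>2/4"] \<open>e > 0\<close> by auto
    have small: "I (u i) - d < e\<^sup>2 / 4" if "i \<ge> N" for i
    proof -
      have "1 / real (Suc i) \<le> 1 / real (Suc N)" using that by (intro divide_left_mono) auto
      then show ?thesis using u(2)[of i] N by linarith
    qed
    have "(\<integral>x. norm (u i x - u j x) \<partial>M) < e" if "i \<ge> N" "j \<ge> N" for i j
    proof (rule power2_less_imp_less)
      show "(\<integral>x. norm (u i x - u j x) \<partial>M)\<^sup>2 < e\<^sup>2"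
        using L1[OF u(1) u(1), of i j] small[OF that(1)] small[OF that(2)] by simp
    qed (use \<open>e > 0\<close> in simp)
    then show ?thesis by blast
  qed
  obtain r where r: "strict_mono r" and C: "AE x in M. Cauchy (\<lambda>i. u (r i) x)"
    by (rule cauchy_L1_AE_cauchy_subseq[of M u, OF _ cauchy]) auto
  define v where "v i = u (r i)" for i
  \<comment> \<open>\<open>lim\<close> picks the pointwise limit where it exists, which is almost
    everywhere, and keeps \<open>g\<close> measurable.\<close>
  define g where "g x = lim (\<lambda>i. v i x)" for x
  have v: "v i \<in> orbit_hull f" for i by (simp add: v_def u)
  have [measurable]: "v i \<in> borel_measurable M" for i by (simp add: v_def)
  have [measurable]: "g \<in> borel_measurable M" unfolding g_def by measurable
  have lim: "AE x in M. (\<lambda>i. v i x) \<longlonglongrightarrow> g x"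
    using C by eventually_elim (simp add: v_def g_def Cauchy_convergent_iff convergent_LIMSEQ_iff)
  have vB: "cmod (v i x) \<le> B" if "x \<in> space M" for i x by (rule orbit_hull_bound[OF B v that])
  have Id: "(\<lambda>i. I (v i)) \<longlonglongrightarrow> d"
  proof (rule tendsto_sandwich[of "\<lambda>_. d" _ _ "\<lambda>i. d + 1 / real (Suc i)"])
    have "I (v i) \<le> d + 1 / real (Suc i)" for i
    proof -
      have "1 / real (Suc (r i)) \<le> 1 / real (Suc i)"
        using seq_suble[OF r, of i] by (intro divide_left_mono) auto
      then show ?thesis using u(2)[of "r i"] by (simp add: v_def)
    qed
    then show "\<forall>\<^sub>F i in sequentially. I (v i) \<le> d + 1 / real (Suc i)" by simp
    show "(\<lambda>i. d + 1 / real (Suc i)) \<longlonglongrightarrow> d"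
      using tendsto_add[OF tendsto_const[of d] LIMSEQ_inverse_real_of_nat] by (simp add: inverse_eq_divide)
  qed (use dle[OF v] in auto)
  \<comment> \<open>Composition with \<open>T\<close> preserves the norm, so \<open>v i\<close> and
    its shift are both near-minimisers and hence close to each other.\<close>
  have IT: "I (\<lambda>x. v i (T x)) = I (v i)" for i
    unfolding I_def using integral_T[of "\<lambda>x. (cmod (v i x))\<^sup>2"] by simp
  have shift0: "(\<lambda>i. \<integral>x. cmod (v i x - v i (T x)) \<partial>M) \<longlonglongrightarrow> 0"
  proof -
    have le: "(\<integral>x. cmod (v i x - v i (T x)) \<partial>M)\<^sup>2 \<le> 4 * (I (v i) - d)" for i
      using L1[OF v orbit_hull.shift[OF v], of i i] IT[of i] by simp
    have "(\<lambda>i. 4 * (I (v i) - d)) \<longlonglongrightarrow> 0"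
      by (rule tendsto_mult_right_zero) (rule LIM_zero[OF Id])
    then have "(\<lambda>i. (\<integral>x. cmod (v i x - v i (T x)) \<partial>M)\<^sup>2) \<longlonglongrightarrow> 0"
      by (rule Lim_null_comparison[rotated])
         (use le in \<open>auto intro!: always_eventually\<close>)
    from tendsto_real_sqrt[OF this] show ?thesis by (simp add: tendsto_rabs_zero_iff)
  qed
  have limT: "AE x in M. (\<lambda>i. v i (T x)) \<longlonglongrightarrow> g (T x)" by (rule AE_T[OF lim])
  \<comment> \<open>The same integrals also converge to the distance between \<open>g\<close> and
    its shift, so that distance is 0 and \<open>g\<close> is invariant almost everywhere.\<close>
  have "(\<lambda>i. \<integral>x. cmod (v i x - v i (T x)) \<partial>M) \<longlonglongrightarrow> (\<integral>x. cmod (g x - g (T x)) \<partial>M)"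
  proof (rule integral_dominated_convergence[where w="\<lambda>_. B + B"])
    show "AE x in M. (\<lambda>i. cmod (v i x - v i (T x))) \<longlonglongrightarrow> cmod (g x - g (T x))"
      using lim limT by eventually_elim (intro tendsto_intros)
    show "AE x in M. norm (cmod (v i x - v i (T x))) \<le> B + B" for i
    proof (rule AE_I2)
      fix x assume x: "x \<in> space M"
      show "norm (cmod (v i x - v i (T x))) \<le> B + B"
        using norm_triangle_ineq4[of "v i x" "v i (T x)"] vB[OF x, of i]
          vB[OF measurable_space[OF T x], of i] by simp
    qed
  qed auto
  then have diff0: "(\<integral>x. cmod (g x - g (T x)) \<partial>M) = 0" using shift0 LIMSEQ_unique by blast
  have gB: "AE x in M. cmod (g x) \<le> B"
    using lim AE_space by eventually_elim (rule Lim_bounded[OF tendsto_norm, of _ _ 0], auto intro: vB)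
  have gi: "integrable M g" by (rule integrable_const_bound[OF gB]) simp
  have "integrable M (\<lambda>x. cmod (g x - g (T x)))"
    using gi integrable_distr[of T M M g] distr_T by (intro integrable_norm Bochner_Integration.integrable_diff) auto
  then have inv: "AE x in M. g (T x) = g x"
    using diff0 by (subst (asm) integral_nonneg_eq_0_iff_AE) auto
  \<comment> \<open>The limit inherits mean 0 from the hull; by ergodicity its real and imaginary
    parts are constant, hence 0.\<close>
  have conv: "(\<lambda>i. \<integral>x. v i x \<partial>M) \<longlonglongrightarrow> (\<integral>x. g x \<partial>M)"
    by (rule integral_dominated_convergence[where w="\<lambda>_. B"]) (use lim vB in auto)
  have "(\<integral>x. g x \<partial>M) = 0"
    using conv by (simp add: orbit_hull_integral[OF f v] f0 LIMSEQ_const_iff)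
  then have ri: "(\<integral>x. Re (g x) \<partial>M) = 0" "(\<integral>x. Im (g x) \<partial>M) = 0" using gi by simp_all
  have "AE x in M. Re (g (T x)) = Re (g x)" "AE x in M. Im (g (T x)) = Im (g x)"
    using inv by (auto elim!: eventually_mono)
  then have "AE x in M. Re (g x) = 0" "AE x in M. Im (g x) = 0"
    using ergodic_invariant_const[OF erg, of "\<lambda>x. Re (g x)"] ergodic_invariant_const[OF erg, of "\<lambda>x. Im (g x)"]
      gi by (simp_all add: ri)
  then have g0: "AE x in M. g x = 0" by eventually_elim (simp add: complex_eq_iff)
  have "(\<lambda>i. \<integral>x. cmod (v i x) \<partial>M) \<longlonglongrightarrow> (\<integral>x. 0 \<partial>M)"
  proof (rule integral_dominated_convergence[where w="\<lambda>_. B"])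
    show "AE x in M. (\<lambda>i. cmod (v i x)) \<longlonglongrightarrow> 0"
      using lim g0 by eventually_elim (auto intro: tendsto_norm_zero)
  qed (use vB in auto)
  then have "\<forall>\<^sub>F i in sequentially. (\<integral>x. cmod (v i x) \<partial>M) < \<epsilon>"
    using \<open>\<epsilon> > 0\<close> by (intro order_tendstoD(2)[of _ 0]) auto
  then obtain i where "(\<integral>x. cmod (v i x) \<partial>M) < \<epsilon>"
    using eventually_happens'[OF sequentially_bot] by blast
  then show ?thesis using v by blast
qed

text \<open>After subtraction of the mean, a hull element \<open>g\<close> of small
  \<open>L^1\<close> norm replaces \<open>f\<close> up to an error whose Folner averages vanish, and
  its own correlations are uniformly small. The constant part contributes the product of the
  integrals.\<close>

theorem mean_ergodic:
  assumes erg: "ergodic_measure M T" and F: "folner F" and f: "f \<in> bfun M" and q: "q \<in> bfun M"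
  shows "mixes F f q"
proof -
  let ?a = "\<integral>x. f x \<partial>M"
  let ?f = "\<lambda>x. f x - ?a"
  have f': "?f \<in> bfun M" by (intro bfun_diff f bfun_const)
  have f0: "(\<integral>x. ?f x \<partial>M) = 0" using f by (simp add: bfun_integrable prob_space)
  obtain K where K: "\<And>x. x \<in> space M \<Longrightarrow> cmod (q x) \<le> K" "K > 0" using q by (elim bfunE) blast
  have zero: "ave F (corr ?f q) \<longlonglongrightarrow> 0"
  proof (rule LIMSEQ_I)
    fix r :: real assume "r > 0"
    \<comment> \<open>The factor \<open>K\<close> is the bound on \<open>q\<close> that enters
      through \<open>corr_bound\<close>, so this choice keeps the correlations of \<open>g\<close>
      below \<open>r / 2\<close>.\<close>
    then obtain g where g: "g \<in> orbit_hull ?f" "(\<integral>x. cmod (g x) \<partial>M) < r / (2 * K)"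
      using orbit_hull_small[OF erg f' f0, of "r / (2 * K)"] K(2) by auto
    have gb: "g \<in> bfun M" using orbit_hull_bfun[OF f' g(1)] .
    have "K * (\<integral>x. cmod (g x) \<partial>M) < r / 2" using g(2) K(2) by (simp add: field_simps)
    then have small: "cmod (ave F (corr g q) m) < r / 2" for m
      using norm_ave_bound[of "corr g q", OF corr_bound[OF gb q K(1)]] by (rule order.strict_trans1[rotated])
    obtain N where N: "\<And>m. m \<ge> N \<Longrightarrow> cmod (ave F (\<lambda>j. corr ?f q j - corr g q j) m) < r / 2"
      using LIMSEQ_D[OF orbit_hull_folner[OF F f' q g(1)], of "r/2"] \<open>r > 0\<close> by auto
    have "cmod (ave F (corr ?f q) m - 0) < r" if "m \<ge> N" for m
      using N[OF that] small[of m] norm_triangle_sub[of "ave F (corr ?f q) m" "ave F (corr g q) m"]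
      unfolding ave_diff by simp
    then show "\<exists>N. \<forall>m\<ge>N. cmod (ave F (corr ?f q) m - 0) < r" by blast
  qed
  have c: "corr (\<lambda>x. ?a) q j = ?a * (\<integral>x. q x \<partial>M)" for j by (simp add: corr_def)
  have const: "ave F (corr (\<lambda>x. ?a) q) \<longlonglongrightarrow> ?a * (\<integral>x. q x \<partial>M)"
  proof (rule tendsto_eventually)
    show "\<forall>\<^sub>F m in sequentially. ave F (corr (\<lambda>x. ?a) q) m = ?a * (\<integral>x. q x \<partial>M)"
      unfolding c using folner_eventually[OF F] by eventually_elim (rule ave_const; simp)
  qed
  have "ave F (corr f q) = (\<lambda>m. ave F (corr ?f q) m + ave F (corr (\<lambda>x. ?a) q) m)"
    unfolding corr_diff[OF f bfun_const q] ave_diff by simp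
  then show ?thesis using tendsto_add[OF zero const] by (simp add: mixes_def)
qed

end

section \<open>Products, weak and strong mixing\<close>

text \<open>Cauchy-Schwarz against the constant 1.\<close>

lemma ave_power2_le:
  fixes x :: "nat \<Rightarrow> real"
  shows "(ave F x m)\<^sup>2 \<le> ave F (\<lambda>j. (x j)\<^sup>2) m"
proof (cases "card (F m) = 0")
  case False
  have "(sum x (F m))\<^sup>2 / (real (card (F m)))\<^sup>2 \<le> ((\<Sum>j\<in>F m. (x j)\<^sup>2) * card (F m)) / (real (card (F m)))\<^sup>2"
    by (intro divide_right_mono sum_squared_le_sum_of_squares) simp
  then show ?thesis using False by (simp add: ave_def power_divide power2_eq_square)
qed (simp add: ave_def)

text \<open>This makes the quadratic condition of weak mixing usable in estimates that are linear in
  the deviations.\<close>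

lemma ave_norm_tendsto_0:
  assumes "ave F (\<lambda>j. (norm (x j))\<^sup>2) \<longlonglongrightarrow> 0"
  shows "ave F (\<lambda>j. norm (x j)) \<longlonglongrightarrow> 0"
proof -
  have "(\<lambda>m. (ave F (\<lambda>j. norm (x j)) m)\<^sup>2) \<longlonglongrightarrow> 0"
    by (rule Lim_null_comparison[OF _ assms]) (simp add: ave_power2_le)
  from tendsto_real_sqrt[OF this] show ?thesis by (simp add: tendsto_rabs_zero_iff)
qed

lemma ave_tendsto_const:
  assumes "folner F" shows "ave F (\<lambda>j. c) \<longlonglongrightarrow> c"
proof (rule tendsto_eventually)
  show "\<forall>\<^sub>F m in sequentially. ave F (\<lambda>j. c) m = c"
    using folner_eventually[OF assms] by eventually_elim (rule ave_const; simp)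
qed

lemma ave_tendstoI:
  fixes b :: "nat \<Rightarrow> 'a :: real_normed_field"
  assumes F: "folner F" and e: "ave F e \<longlonglongrightarrow> 0" and le: "\<And>j. norm (b j - c) \<le> e j"
  shows "ave F b \<longlonglongrightarrow> c"
proof -
  have "ave F (\<lambda>j. b j - c) \<longlonglongrightarrow> 0"
  proof (rule Lim_null_comparison[OF _ e])
    show "\<forall>\<^sub>F m in sequentially. norm (ave F (\<lambda>j. b j - c) m) \<le> ave F e m"
      using order_trans[OF norm_ave_le ave_mono[OF le]] by simp
  qed
  from tendsto_add[OF this ave_tendsto_const[OF F, of c]] show ?thesis
    unfolding fun_cong[OF ave_add, symmetric] by simp
qed

section \<open>Tensor products and the product system\<close>

definition tensor :: "('a \<Rightarrow> complex) \<Rightarrow> ('b \<Rightarrow> complex) \<Rightarrow> 'a \<times> 'b \<Rightarrow> complex" where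
  "tensor f g = (\<lambda>p. f (fst p) * g (snd p))"

lemma tensor_bfun:
  assumes "f \<in> bfun M" "g \<in> bfun N" shows "tensor f g \<in> bfun (M \<Otimes>\<^sub>M N)"
  unfolding tensor_def by (intro bfun_mult bfun_compose[OF assms(1)] bfun_compose[OF assms(2)]) auto

lemma integral_tensor:
  assumes "prob_space M" "prob_space N" and f: "f \<in> bfun M" and g: "g \<in> bfun N"
  shows "(\<integral>p. tensor f g p \<partial>(M \<Otimes>\<^sub>M N)) = (\<integral>x. f x \<partial>M) * (\<integral>y. g y \<partial>N)"
proof -
  interpret M: prob_space M by fact
  interpret N: prob_space N by fact
  interpret pair_prob_space M N ..
  have "integrable (M \<Otimes>\<^sub>M N) (tensor f g)" by (rule P.bfun_integrable[OF tensor_bfun[OF f g]])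
  from integral_fst'[OF this] show ?thesis by (simp add: tensor_def)
qed

text \<open>A class on the product can thus be examined one variable at a time; the bound on
  \<open>g\<close> keeps the tensors of a bounded sequence bounded.\<close>

lemma closed_class_tensor_left:
  assumes V: "closed_class (X \<times> Y) V" and B: "\<And>y. y \<in> Y \<Longrightarrow> cmod (g y) \<le> B"
  shows "closed_class X {f. tensor f g \<in> V}"
proof (rule closed_classI, goal_cases)
  case (1 f c)
  then show ?case using closed_class_scale[OF V, of _ c] by (simp add: tensor_def mult.assoc)
next
  case (2 f h)
  then show ?case using closed_class_add[OF V, of "tensor f g" "tensor h g"] by (simp add: tensor_def distrib_right)
next
  case (3 u f K)
  have "tensor f g \<in> V"
  proof (rule closed_class_lim[OF V, of "\<lambda>n. tensor (u n) g" "K * B"])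
    show "cmod (tensor (u n) g p) \<le> K * B" if "p \<in> X \<times> Y" for n p
      using that 3(2)[of "fst p" n] B[of "snd p"]
      by (auto simp: tensor_def norm_mult intro!: mult_mono order_trans[OF norm_ge_zero])
    show "(\<lambda>n. tensor (u n) g p) \<longlonglongrightarrow> tensor f g p" if "p \<in> X \<times> Y" for p
      unfolding tensor_def using that by (intro tendsto_intros 3(3)) auto
  qed (use 3(1) in simp)
  then show ?case by simp
qed

lemma closed_class_tensor_right:
  assumes V: "closed_class (X \<times> Y) V" and B: "\<And>x. x \<in> X \<Longrightarrow> cmod (f x) \<le> B"
  shows "closed_class Y {g. tensor f g \<in> V}"
proof (rule closed_classI, goal_cases)
  case (1 g c)
  then show ?case using closed_class_scale[OF V, of _ c] by (simp add: tensor_def mult.left_commute)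
next
  case (2 g h)
  then show ?case using closed_class_add[OF V, of "tensor f g" "tensor f h"] by (simp add: tensor_def distrib_left)
next
  case (3 u g K)
  have "tensor f g \<in> V"
  proof (rule closed_class_lim[OF V, of "\<lambda>n. tensor f (u n)" "B * K"])
    show "cmod (tensor f (u n) p) \<le> B * K" if "p \<in> X \<times> Y" for n p
      using that 3(2)[of "snd p" n] B[of "fst p"]
      by (auto simp: tensor_def norm_mult intro!: mult_mono order_trans[OF norm_ge_zero])
    show "(\<lambda>n. tensor f (u n) p) \<longlonglongrightarrow> tensor f g p" if "p \<in> X \<times> Y" for p
      unfolding tensor_def using that by (intro tendsto_intros 3(3)) auto
  qed (use 3(1) in simp)
  then show ?case by simp
qed

text \<open>Fixing one factor at a time extends membership from tensors of generators to tensors of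
  all bounded functions. These include the indicators of rectangles, which generate the product
  sigma-algebra.\<close>

lemma total_family_tensor:
  assumes M: "total_family M E" and N: "total_family N E'" and E': "E' \<subseteq> bfun N"
  shows "total_family (M \<Otimes>\<^sub>M N) {tensor e e' |e e'. e \<in> E \<and> e' \<in> E'}"
  unfolding total_family_def
proof (intro allI impI)
  fix V assume V: "closed_class (space (M \<Otimes>\<^sub>M N)) V" and sub: "{tensor e e' |e e'. e \<in> E \<and> e' \<in> E'} \<subseteq> V"
  then have V': "closed_class (space M \<times> space N) V" by (simp add: space_pair_measure)
  have left: "tensor f e' \<in> V" if f: "f \<in> bfun M" and e': "e' \<in> E'" for f e'
  proof -
    obtain B where B: "\<And>y. y \<in> space N \<Longrightarrow> cmod (e' y) \<le> B" using subsetD[OF E' e'] by (elim bfunE) blast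
    have "f \<in> {f. tensor f e' \<in> V}"
      by (rule total_familyD[OF M closed_class_tensor_left[OF V' B] _ f]) (use sub e' in auto)
    then show ?thesis by simp
  qed
  have both: "tensor f g \<in> V" if f: "f \<in> bfun M" and g: "g \<in> bfun N" for f g
  proof -
    obtain B where B: "\<And>x. x \<in> space M \<Longrightarrow> cmod (f x) \<le> B" using f by (elim bfunE) blast
    have "g \<in> {g. tensor f g \<in> V}"
      by (rule total_familyD[OF N closed_class_tensor_right[OF V' B] _ g]) (use left[OF f] in auto)
    then show ?thesis by simp
  qed
  show "bfun (M \<Otimes>\<^sub>M N) \<subseteq> V"
  proof (rule total_family_generator[OF V])
    let ?G = "{a \<times> b |a b. a \<in> sets M \<and> b \<in> sets N}"
    show "Int_stable ?G" by (rule Int_stable_pair_measure_generator)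
    show "?G \<subseteq> Pow (space (M \<Otimes>\<^sub>M N))"
      unfolding space_pair_measure by (rule pair_measure_closed)
    show "sets (M \<Otimes>\<^sub>M N) = sigma_sets (space (M \<Otimes>\<^sub>M N)) ?G"
      by (simp add: sets_pair_measure space_pair_measure)
    show "(\<lambda>x. 1) \<in> V" using both[OF bfun_const[of 1] bfun_const[of 1]] by (simp add: tensor_def)
    fix S assume "S \<in> ?G"
    then obtain a b where S: "S = a \<times> b" "a \<in> sets M" "b \<in> sets N" by blast
    have "tensor (indicator a) (indicator b) = indicator S"
      by (auto simp: tensor_def S indicator_def fun_eq_iff)
    then show "indicator S \<in> V" using both[OF bfun_indicator[OF S(2)] bfun_indicator[OF S(3)]] by simp
  qed
qed

context mp_system
begin

abbreviation T2 :: "'a \<times> 'a \<Rightarrow> 'a \<times> 'a" where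
  "T2 \<equiv> \<lambda>(x, y). (T x, T y)"

lemma mp_system_pair: "mp_system (M \<Otimes>\<^sub>M M) T2"
proof -
  have sf: "sigma_finite_measure (distr M M T)"
    unfolding distr_T by (rule prob_space_imp_sigma_finite[OF prob_space_axioms])
  interpret pair_prob_space M M ..
  show ?thesis
  proof
    show "T2 \<in> measurable (M \<Otimes>\<^sub>M M) (M \<Otimes>\<^sub>M M)" by measurable
    from pair_measure_distr[OF T T sf] show "distr (M \<Otimes>\<^sub>M M) (M \<Otimes>\<^sub>M M) T2 = M \<Otimes>\<^sub>M M"
      unfolding distr_T by simp
  qed
qed

interpretation pair: mp_system "M \<Otimes>\<^sub>M M" T2
  by (rule mp_system_pair)

lemma T2_funpow: "(T2 ^^ j) p = ((T ^^ j) (fst p), (T ^^ j) (snd p))"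
  by (induction j) auto

text \<open>The iterates of \<open>T2\<close> act coordinatewise, so the integrand is again a tensor
  and Fubini splits the integral.\<close>

lemma pair_corr_tensor:
  assumes "f \<in> bfun M" "g \<in> bfun M" "p \<in> bfun M" "q \<in> bfun M"
  shows "pair.corr (tensor f g) (tensor p q) j = corr f p j * corr g q j"
proof -
  let ?u = "\<lambda>x. f ((T ^^ j) x) * p x" and ?v = "\<lambda>x. g ((T ^^ j) x) * q x"
  have b: "?u \<in> bfun M" "?v \<in> bfun M"
    by (intro bfun_mult bfun_compose[OF _ funpow_measurable] assms)+
  have "(\<lambda>z. tensor f g ((T2 ^^ j) z) * tensor p q z) = tensor ?u ?v"
    by (simp add: T2_funpow tensor_def fun_eq_iff)
  then show ?thesis
    unfolding pair.corr_def corr_def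
    using integral_tensor[OF prob_space_axioms prob_space_axioms b] by simp
qed

lemma integral_tensor':
  "f \<in> bfun M \<Longrightarrow> g \<in> bfun M \<Longrightarrow> (\<integral>p. tensor f g p \<partial>(M \<Otimes>\<^sub>M M)) = (\<integral>x. f x \<partial>M) * (\<integral>y. g y \<partial>M)"
  by (rule integral_tensor[OF prob_space_axioms prob_space_axioms])

lemma bfun_cnj: "f \<in> bfun M \<Longrightarrow> (\<lambda>x. cnj (f x)) \<in> bfun M"
  by (auto simp: bfun_def intro!: borel_measurable_continuous_on[of cnj] continuous_intros)

text \<open>The square is expanded. Both \<open>corr f q j\<close> and its squared modulus are
  correlations of tensors for \<open>T2\<close>, whose averages the mean ergodic theorem evaluates,
  since weak mixing is ergodicity of \<open>T2\<close>.\<close>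

lemma weakly_mixing_corr:
  assumes wm: "weakly_mixing M T" and F: "folner F" and f: "f \<in> bfun M" and q: "q \<in> bfun M"
  shows "ave F (\<lambda>j. (cmod (corr f q j - (\<integral>x. f x \<partial>M) * (\<integral>x. q x \<partial>M)))\<^sup>2) \<longlonglongrightarrow> 0"
proof -
  define c where "c = (\<integral>x. f x \<partial>M) * (\<integral>x. q x \<partial>M)"
  note mix = pair.mean_ergodic[OF wm[unfolded weakly_mixing_def] F tensor_bfun tensor_bfun]
  have cnj: "corr (\<lambda>x. cnj (f x)) (\<lambda>x. cnj (q x)) j = cnj (corr f q j)" for j
    unfolding corr_def by (simp flip: complex_cnj_mult integral_cnj)
  note b = f q bfun_cnj[OF f] bfun_cnj[OF q] bfun_const[of 1 M]
  \<comment> \<open>Conjugates in the second factor turn the product of correlations into a squared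
    modulus.\<close>
  have sq: "ave F (\<lambda>j. corr f q j * cnj (corr f q j)) \<longlonglongrightarrow> c * cnj c"
  proof -
    have "pair.corr (tensor f (\<lambda>x. cnj (f x))) (tensor q (\<lambda>x. cnj (q x)))
      = (\<lambda>j. corr f q j * cnj (corr f q j))"
      using b by (intro ext) (simp add: pair_corr_tensor cnj)
    moreover have "pair.mixes F (tensor f (\<lambda>x. cnj (f x))) (tensor q (\<lambda>x. cnj (q x)))"
      by (intro mix b)
    ultimately show ?thesis
      using b by (simp add: pair.mixes_def integral_tensor' c_def ac_simps)
  qed
  \<comment> \<open>A constant second factor recovers the plain correlation.\<close>
  have one: "ave F (corr f q) \<longlonglongrightarrow> c"
  proof -
    have "corr (\<lambda>x. 1) (\<lambda>x. 1) j = 1" for j by (simp add: corr_def prob_space)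
    then have "pair.corr (tensor f (\<lambda>x. 1)) (tensor q (\<lambda>x. 1)) = corr f q"
      using b by (intro ext) (simp add: pair_corr_tensor)
    moreover have "pair.mixes F (tensor f (\<lambda>x. 1)) (tensor q (\<lambda>x. 1))"
      by (intro mix b)
    ultimately show ?thesis
      using b by (simp add: pair.mixes_def integral_tensor' c_def prob_space)
  qed
  have cnj_ave: "ave F (\<lambda>j. cnj (b j)) = (\<lambda>m. cnj (ave F b m))" for b
    by (simp add: ave_def fun_eq_iff)
  have of_real_ave: "ave F (\<lambda>j. complex_of_real (b j)) = (\<lambda>m. complex_of_real (ave F b m))" for b
    by (simp add: ave_def fun_eq_iff)
  \<comment> \<open>The expansion keeps the constants on the left of the varying factors, as
    \<open>ave_scale\<close> expects.\<close>
  have eq: "complex_of_real ((cmod (a - c))\<^sup>2) = ((a * cnj a - cnj c * a) - c * cnj a) + c * cnj c" for a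
    by (simp only: complex_norm_square complex_cnj_diff) (simp add: algebra_simps)
  have "ave F (\<lambda>j. complex_of_real ((cmod (corr f q j - c))\<^sup>2)) \<longlonglongrightarrow>
      ((c * cnj c - cnj c * c) - c * cnj c) + c * cnj c"
    unfolding eq ave_add ave_diff ave_scale cnj_ave
    by (intro tendsto_intros sq one ave_tendsto_const[OF F])
  then have "(\<lambda>m. complex_of_real (ave F (\<lambda>j. (cmod (corr f q j - c))\<^sup>2) m)) \<longlonglongrightarrow> complex_of_real 0"
    unfolding of_real_ave by simp
  then show ?thesis unfolding c_def by (simp only: tendsto_of_real_iff)
qed

text \<open>It suffices to treat tensors of generators. There the deviation of a product splits as
  \<open>a * b - c * d = b * (a - c) + c * (b - d)\<close>; with \<open>b\<close> bounded, the
  average is controlled by the mean absolute deviations of the two factors.\<close>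

lemma weakly_mixingI:
  assumes F: "folner F" and tot: "total_family M E" and E: "E \<subseteq> bfun M"
    and conv: "\<And>e e'. e \<in> E \<Longrightarrow> e' \<in> E \<Longrightarrow>
      ave F (\<lambda>j. (cmod (corr e e' j - (\<integral>x. e x \<partial>M) * (\<integral>x. e' x \<partial>M)))\<^sup>2) \<longlonglongrightarrow> 0"
  shows "weakly_mixing M T"
  unfolding weakly_mixing_def
proof (rule pair.mixes_imp_ergodic[OF folner_eventually[OF F]])
  let ?E = "{tensor e e' |e e'. e \<in> E \<and> e' \<in> E}"
  have mix: "pair.mixes F (tensor e1 e2) (tensor e3 e4)"
    if E4: "e1 \<in> E" "e2 \<in> E" "e3 \<in> E" "e4 \<in> E" for e1 e2 e3 e4
  proof -
    have b: "e1 \<in> bfun M" "e2 \<in> bfun M" "e3 \<in> bfun M" "e4 \<in> bfun M" using that E by auto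
    let ?c = "(\<integral>x. e1 x \<partial>M) * (\<integral>x. e3 x \<partial>M)" and ?d = "(\<integral>x. e2 x \<partial>M) * (\<integral>x. e4 x \<partial>M)"
    obtain B where B: "\<And>x. x \<in> space M \<Longrightarrow> cmod (e4 x) \<le> B" using b by (elim bfunE) blast
    define K where "K = B * (\<integral>x. cmod (e2 x) \<partial>M)"
    have K: "cmod (corr e2 e4 j) \<le> K" for j unfolding K_def by (rule corr_bound[OF b(2,4) B])
    let ?e = "\<lambda>j. K * cmod (corr e1 e3 j - ?c) + cmod ?c * cmod (corr e2 e4 j - ?d)"
    have "ave F ?e \<longlonglongrightarrow> 0"
      unfolding ave_add ave_scale
      by (intro tendsto_add_zero tendsto_mult_right_zero ave_norm_tendsto_0 conv E4)
    moreover have "cmod (corr e1 e3 j * corr e2 e4 j - ?c * ?d) \<le> ?e j" for j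
    proof -
      have eq: "corr e1 e3 j * corr e2 e4 j - ?c * ?d =
          corr e2 e4 j * (corr e1 e3 j - ?c) + ?c * (corr e2 e4 j - ?d)" by (simp add: algebra_simps)
      have "cmod (corr e1 e3 j * corr e2 e4 j - ?c * ?d) \<le> cmod (corr e2 e4 j) * cmod (corr e1 e3 j - ?c) + cmod ?c * cmod (corr e2 e4 j - ?d)"
        unfolding eq norm_mult[symmetric] by (rule norm_triangle_ineq)
      also have "\<dots> \<le> ?e j"
        by (intro add_right_mono mult_right_mono K norm_ge_zero)
      finally show ?thesis .
    qed
    ultimately have "ave F (\<lambda>j. corr e1 e3 j * corr e2 e4 j) \<longlonglongrightarrow> ?c * ?d"
      by (rule ave_tendstoI[OF F])
    moreover have "pair.corr (tensor e1 e2) (tensor e3 e4) = (\<lambda>j. corr e1 e3 j * corr e2 e4 j)"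
      using b by (intro ext) (simp add: pair_corr_tensor)
    ultimately show ?thesis using b by (simp add: pair.mixes_def integral_tensor' ac_simps)
  qed
  show "pair.mixes F f q" if "f \<in> bfun (M \<Otimes>\<^sub>M M)" "q \<in> bfun (M \<Otimes>\<^sub>M M)" for f q
  proof (rule pair.mixes_total[OF total_family_tensor[OF tot tot E] _ _ that])
    show "?E \<subseteq> bfun (M \<Otimes>\<^sub>M M)" using E by (auto intro!: tensor_bfun)
  qed (use mix in blast)
qed

section \<open>Strong mixing as mixing along singletons\<close>

lemma ave_singleton: "ave (\<lambda>m. {m}) b = b"
  by (simp add: ave_def fun_eq_iff)

text \<open>For indicators, mixing along singletons is the definition of strong mixing; totality of
  the indicators carries it to all bounded functions.\<close>

lemma strongly_mixing_iff:
  "strongly_mixing M T \<longleftrightarrow> (\<forall>f\<in>bfun M. \<forall>q\<in>bfun M. mixes (\<lambda>m. {m}) f q)"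
proof -
  have ind: "mixes (\<lambda>m. {m}) (indicator S) (indicator S') \<longleftrightarrow>
      (\<lambda>j. measure M ((T ^^ j) -` S \<inter> space M \<inter> S')) \<longlonglongrightarrow> measure M S * measure M S'"
    if S [measurable]: "S \<in> sets M" "S' \<in> sets M" for S S'
  proof -
    have "corr (indicator S) (indicator S') = (\<lambda>j. complex_of_real (measure M ((T ^^ j) -` S \<inter> space M \<inter> S')))"
    proof
      fix j
      have "corr (indicator S) (indicator S') j = (\<integral>x. indicator ((T ^^ j) -` S \<inter> space M \<inter> S') x \<partial>M)"
        unfolding corr_def by (intro Bochner_Integration.integral_cong) (auto simp: indicator_def)
      also have "\<dots> = complex_of_real (measure M ((T ^^ j) -` S \<inter> space M \<inter> S'))"
        by (intro integral_indicator_complex) measurable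
      finally show "corr (indicator S) (indicator S') j = complex_of_real (measure M ((T ^^ j) -` S \<inter> space M \<inter> S'))" .
    qed
    then have "mixes (\<lambda>m. {m}) (indicator S) (indicator S') \<longleftrightarrow>
      (\<lambda>j. complex_of_real (measure M ((T ^^ j) -` S \<inter> space M \<inter> S'))) \<longlonglongrightarrow> complex_of_real (measure M S * measure M S')"
      unfolding mixes_def ave_singleton integral_indicator_complex[OF S(1)] integral_indicator_complex[OF S(2)]
      by simp
    then show ?thesis by (simp only: tendsto_of_real_iff)
  qed
  show ?thesis
  proof
    assume sm: "strongly_mixing M T"
    show "\<forall>f\<in>bfun M. \<forall>q\<in>bfun M. mixes (\<lambda>m. {m}) f q"
    proof (intro ballI)
      fix f q assume fq: "f \<in> bfun M" "q \<in> bfun M"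
      show "mixes (\<lambda>m. {m}) f q"
      proof (rule mixes_total[OF total_family_indicators _ _ fq])
        show "mixes (\<lambda>m. {m}) e e'"
          if "e \<in> {indicator S |S. S \<in> sets M}" "e' \<in> {indicator S |S. S \<in> sets M}" for e e'
          using that sm ind unfolding strongly_mixing_def by blast
      qed auto
    qed
  next
    assume "\<forall>f\<in>bfun M. \<forall>q\<in>bfun M. mixes (\<lambda>m. {m}) f q"
    then show "strongly_mixing M T"
      unfolding strongly_mixing_def using ind bfun_indicator by blast
  qed
qed

end

section \<open>Characters of the torus\<close>

lemma torus_nonzero: "z \<in> torus \<Longrightarrow> z $ i \<noteq> 0"
  by (metis (mono_tags) mem_Collect_eq norm_zero torus_def zero_neq_one)

lemma charz_0 [simp]: "charz z 0 = 1"
  by (simp add: charz_def)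

lemma charz_add: "z \<in> torus \<Longrightarrow> charz z (k + l) = charz z k * charz z l"
  by (simp add: charz_def power_int_add torus_nonzero prod.distrib)

lemma norm_charz: "z \<in> torus \<Longrightarrow> cmod (charz z k) = 1"
  by (simp add: charz_def norm_power_int torus_def flip: prod_norm)

lemma power_int_sum:
  "(x :: complex) \<noteq> 0 \<Longrightarrow> finite I \<Longrightarrow> x powi (\<Sum>i\<in>I. f i) = (\<Prod>i\<in>I. x powi f i)"
  by (induction I rule: infinite_finite_induct) (auto simp: power_int_add)

lemma power_int_prod: "(\<Prod>i\<in>I. f i :: complex) powi n = (\<Prod>i\<in>I. f i powi n)"
  by (induction I rule: infinite_finite_induct) (auto simp: power_int_mult_distrib)

text \<open>Duality: the row action of \<open>A\<close> on the torus pulls characters back along the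
  column action on exponents, by exchanging the two products.\<close>

lemma charz_times_map:
  assumes "z \<in> torus" shows "charz (times_map A z) k = charz z (A *v k)"
proof -
  have "charz (times_map A z) k = (\<Prod>j\<in>UNIV. \<Prod>i\<in>UNIV. z $ i powi (A $ i $ j * k $ j))"
    by (simp add: charz_def times_map_def power_int_prod power_int_mult)
  also have "\<dots> = (\<Prod>i\<in>UNIV. \<Prod>j\<in>UNIV. z $ i powi (A $ i $ j * k $ j))" by (rule prod.swap)
  also have "\<dots> = charz z (A *v k)"
    by (simp add: charz_def matrix_vector_mult_def power_int_sum torus_nonzero[OF assms])
  finally show ?thesis .
qed

lemma times_map_torus: "z \<in> torus \<Longrightarrow> times_map A z \<in> torus"
  by (simp add: times_map_def torus_def norm_power_int flip: prod_norm)

lemma charz_funpow: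
  "z \<in> torus \<Longrightarrow> charz ((times_map A ^^ j) z) k = charz z (mat_pow A j *v k)"
proof (induction j arbitrary: z)
  case (Suc j)
  have "(times_map A ^^ Suc j) z = (times_map A ^^ j) (times_map A z)" by (simp add: funpow_swap1)
  then show ?case
    using Suc.IH[OF times_map_torus[OF Suc.prems]] charz_times_map[OF Suc.prems]
    by (simp only: mat_pow.simps matrix_vector_mul_assoc)
qed simp

text \<open>\<open>mat_pow\<close> multiplies on the left, whereas replacing \<open>k\<close> by
  \<open>A *v k\<close> puts the factor on the right.\<close>

lemma mat_pow_commute: "mat_pow A j ** A = A ** mat_pow A j"
proof (induction j)
  case (Suc j)
  have "mat_pow A (Suc j) ** A = A ** (mat_pow A j ** A)" by (simp add: matrix_mul_assoc)
  then show ?case using Suc by simp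
qed simp

lemma borel_measurable_charz: "(\<lambda>z. charz z k) \<in> borel_measurable borel"
proof -
  have [measurable]: "(\<lambda>z :: complex ^ 'n. z $ i) \<in> borel_measurable borel" for i
    by (intro borel_measurable_continuous_onI continuous_intros)
  show ?thesis unfolding charz_def power_int_def by measurable
qed

lemma borel_measurable_times_map: "times_map A \<in> borel_measurable (borel :: (complex ^ 'n) measure)"
proof -
  \<comment> \<open>The \<open>j\<close>-th coordinate is the character of the \<open>j\<close>-th
    column of \<open>A\<close>.\<close>
  have c: "(\<lambda>z. times_map A z $ j) \<in> borel_measurable borel" for j
    using borel_measurable_charz[of "\<chi> i. A $ i $ j"] by (simp add: charz_def times_map_def)
  have "(\<lambda>z. times_map A z \<bullet> b) \<in> borel_measurable borel" if b: "b \<in> Basis" for b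
  proof -
    obtain j u where eq: "b = axis j u" using b unfolding Basis_vec_def by blast
    show ?thesis unfolding eq inner_axis using c[of j] by measurable
  qed
  then show ?thesis by (subst borel_measurable_euclidean_space) auto
qed

lemma closed_torus: "closed (torus :: (complex ^ 'n) set)"
proof -
  have eq: "torus = (\<Inter>i. {z :: complex ^ 'n. norm (z $ i) = 1})" by (auto simp: torus_def)
  show ?thesis unfolding eq by (intro closed_INT ballI closed_Collect_eq continuous_intros)
qed

lemma compact_torus: "compact (torus :: (complex ^ 'n) set)"
proof -
  have "norm z \<le> real CARD('n)" if "z \<in> torus" for z :: "complex ^ 'n"
  proof -
    have "norm z \<le> (\<Sum>i\<in>UNIV. norm (z $ i))" unfolding norm_vec_def by (rule L2_set_le_sum) simp
    also have "\<dots> = real CARD('n)" using that by (simp add: torus_def)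
    finally show ?thesis .
  qed
  then show ?thesis using closed_torus by (auto simp: compact_eq_bounded_closed bounded_iff)
qed

section \<open>Trigonometric polynomials and Stone-Weierstrass\<close>

inductive_set trig :: "(complex ^ 'n \<Rightarrow> complex) set" where
  char: "(\<lambda>z. charz z k) \<in> trig"
| scale: "f \<in> trig \<Longrightarrow> (\<lambda>z. c * f z) \<in> trig"
| add: "f \<in> trig \<Longrightarrow> g \<in> trig \<Longrightarrow> (\<lambda>z. f z + g z) \<in> trig"

text \<open>Equality is asked for on the torus only: there products of characters are characters and
  conjugation is inversion, whereas negative powers spoil this at zero coordinates.\<close>

definition on_torus_trig :: "(complex ^ 'n \<Rightarrow> complex) \<Rightarrow> bool" where
  "on_torus_trig f \<longleftrightarrow> (\<exists>p\<in>trig. \<forall>z\<in>torus. p z = f z)"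

lemma on_torus_trig_char: "on_torus_trig (\<lambda>z. charz z k)"
  unfolding on_torus_trig_def by (auto intro: trig.char)

lemma on_torus_trig_scale:
  assumes "on_torus_trig f" shows "on_torus_trig (\<lambda>z. c * f z)"
proof -
  obtain p where p: "p \<in> trig" "\<forall>z\<in>torus. p z = f z" using assms by (auto simp: on_torus_trig_def)
  show ?thesis unfolding on_torus_trig_def by (rule bexI[OF _ trig.scale[OF p(1)]]) (use p in auto)
qed

lemma on_torus_trig_add:
  assumes "on_torus_trig f" "on_torus_trig g" shows "on_torus_trig (\<lambda>z. f z + g z)"
proof -
  obtain p q where p: "p \<in> trig" "q \<in> trig" "\<forall>z\<in>torus. p z = f z" "\<forall>z\<in>torus. q z = g z"
    using assms by (auto simp: on_torus_trig_def)
  show ?thesis unfolding on_torus_trig_def by (rule bexI[OF _ trig.add[OF p(1,2)]]) (use p in auto)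
qed

lemma on_torus_trig_const: "on_torus_trig (\<lambda>z. c)"
  using on_torus_trig_scale[OF on_torus_trig_char[of 0], of c] by simp

lemma on_torus_trig_cong: "on_torus_trig f \<Longrightarrow> (\<And>z. z \<in> torus \<Longrightarrow> f z = g z) \<Longrightarrow> on_torus_trig g"
  unfolding on_torus_trig_def by auto

lemma on_torus_trig_sum: "(\<And>i. i \<in> I \<Longrightarrow> on_torus_trig (f i)) \<Longrightarrow> on_torus_trig (\<lambda>z. \<Sum>i\<in>I. f i z)"
  by (induction I rule: infinite_finite_induct) (auto intro: on_torus_trig_const on_torus_trig_add)

lemma on_torus_trig_mult:
  assumes "on_torus_trig f" "on_torus_trig g" shows "on_torus_trig (\<lambda>z. f z * g z)"
proof -
  have charz_mult: "on_torus_trig (\<lambda>z. charz z k * q z)" if "q \<in> trig" for k and q :: "complex ^ 'n \<Rightarrow> complex"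
    using that
  proof induction
    case (char l)
    show ?case by (rule on_torus_trig_cong[OF on_torus_trig_char[of "k + l"]]) (rule charz_add)
  next
    case (scale q c)
    from on_torus_trig_scale[OF scale.IH, of c] show ?case by (simp add: mult.left_commute)
  next
    case (add q r)
    from on_torus_trig_add[OF add.IH] show ?case by (simp add: distrib_left)
  qed
  have both: "on_torus_trig (\<lambda>z. p z * q z)" if "p \<in> trig" "q \<in> trig" for p q :: "complex ^ 'n \<Rightarrow> complex"
    using that(1)
  proof induction
    case (char k)
    show ?case by (rule charz_mult[OF that(2)])
  next
    case (scale p c)
    from on_torus_trig_scale[OF scale.IH, of c] show ?case by (simp add: mult.assoc)
  next
    case (add p r)
    from on_torus_trig_add[OF add.IH] show ?case by (simp add: distrib_right)
  qed
  obtain p q where p: "p \<in> trig" "q \<in> trig" "\<forall>z\<in>torus. p z = f z" "\<forall>z\<in>torus. q z = g z"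
    using assms by (auto simp: on_torus_trig_def)
  show ?thesis by (rule on_torus_trig_cong[OF both[OF p(1,2)]]) (use p in auto)
qed

lemma charz_axis: "charz z (axis i m) = z $ i powi m"
proof -
  have "charz z (axis i m) = (\<Prod>j\<in>UNIV. if j = i then z $ i powi m else 1)"
    unfolding charz_def by (intro prod.cong) (auto simp: axis_def)
  then show ?thesis by simp
qed

text \<open>On the torus the conjugate of a coordinate \<open>w\<close> is its inverse, so its real
  and imaginary parts are \<open>(w + inverse w) / 2\<close> and
  \<open>(w - inverse w) / (2 * \<i>)\<close>.\<close>

lemma on_torus_trig_component:
  assumes "u = 1 \<or> u = \<i>"
  shows "on_torus_trig (\<lambda>z. complex_of_real (z $ i \<bullet> u))"
proof -
  have cnj: "cnj (z $ i) = charz z (axis i (-1))" if "z \<in> torus" for z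
  proof -
    have "z $ i * cnj (z $ i) = 1"
      using that by (simp add: complex_norm_square[symmetric] torus_def)
    then have "cnj (z $ i) = inverse (z $ i)"
      using inverse_unique by metis
    then show ?thesis by (simp add: charz_axis power_int_minus)
  qed
  from assms show ?thesis
  proof
    assume u: "u = 1"
    have "on_torus_trig (\<lambda>z. 1/2 * (charz z (axis i 1) + charz z (axis i (-1))))"
      by (intro on_torus_trig_scale on_torus_trig_add on_torus_trig_char)
    then show ?thesis
      by (rule on_torus_trig_cong)
         (use u in \<open>simp add: cnj[symmetric] charz_axis[of _ _ 1] complex_eq_iff inner_complex_def\<close>)
  next
    assume u: "u = \<i>"
    have "on_torus_trig (\<lambda>z. - \<i>/2 * (charz z (axis i 1) + (-1) * charz z (axis i (-1))))"
      by (intro on_torus_trig_scale on_torus_trig_add on_torus_trig_char)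
    then show ?thesis
      by (rule on_torus_trig_cong)
         (use u in \<open>simp add: cnj[symmetric] charz_axis[of _ _ 1] complex_eq_iff inner_complex_def\<close>)
  qed
qed

text \<open>A linear functional is a combination of real and imaginary parts of the coordinates;
  sums and products stay within trigonometric polynomials.\<close>

lemma on_torus_trig_polynomial:
  "real_polynomial_function g \<Longrightarrow> on_torus_trig (\<lambda>z. complex_of_real (g z))"
proof (induction rule: real_polynomial_function.induct)
  case (linear g)
  interpret bounded_linear g by fact
  have eq: "complex_of_real (g z) = (\<Sum>b\<in>Basis. complex_of_real (g b) * complex_of_real (z \<bullet> b))" for z
  proof -
    have "g z = g (\<Sum>b\<in>Basis. (z \<bullet> b) *\<^sub>R b)" by (simp add: euclidean_representation)
    also have "\<dots> = (\<Sum>b\<in>Basis. (z \<bullet> b) * g b)" by (simp add: sum scaleR)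
    finally show ?thesis by (simp add: mult.commute)
  qed
  have "on_torus_trig (\<lambda>z. complex_of_real (z \<bullet> b))" if b: "b \<in> Basis" for b :: "complex ^ 'n"
  proof -
    obtain i u where "b = axis i u" "u \<in> Basis" using b unfolding Basis_vec_def by blast
    then show ?thesis using on_torus_trig_component[of u i] by (simp add: inner_axis Basis_complex_def)
  qed
  then have "on_torus_trig (\<lambda>z. \<Sum>b\<in>Basis. complex_of_real (g b) * complex_of_real (z \<bullet> b))"
    by (intro on_torus_trig_sum on_torus_trig_scale)
  then show ?case by (rule on_torus_trig_cong) (rule eq[symmetric])
next
  case (const c)
  show ?case by (rule on_torus_trig_const)
next
  case (add f g)
  from on_torus_trig_add[OF add.IH] show ?case by simp
next
  case (mult f g)
  from on_torus_trig_mult[OF mult.IH] show ?case by simp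
qed

lemma trig_approx:
  fixes f :: "complex ^ 'n \<Rightarrow> real"
  assumes "continuous_on torus f" "e > 0"
  obtains p where "p \<in> trig" "\<And>z. z \<in> torus \<Longrightarrow> cmod (p z - complex_of_real (f z)) < e"
proof -
  obtain g where g: "real_polynomial_function g" "\<And>z. z \<in> torus \<Longrightarrow> \<bar>f z - g z\<bar> < e"
    using Stone_Weierstrass_real_polynomial_function[OF compact_torus assms] by blast
  obtain p where p: "p \<in> trig" "\<forall>z\<in>torus. p z = complex_of_real (g z)"
    using on_torus_trig_polynomial[OF g(1)] by (auto simp: on_torus_trig_def)
  show ?thesis
  proof (rule that[OF p(1)])
    fix z :: "complex ^ 'n" assume z: "z \<in> torus"
    have "cmod (p z - complex_of_real (f z)) = \<bar>g z - f z\<bar>"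
      using p(2) z by (simp flip: of_real_diff)
    then show "cmod (p z - complex_of_real (f z)) < e" using g(2)[OF z] by simp
  qed
qed

lemma closed_class_trig:
  assumes "closed_class X V" "\<And>k. (\<lambda>z. charz z k) \<in> V" "p \<in> trig"
  shows "p \<in> V"
  using assms(3) by induction (auto intro: closed_class_scale closed_class_add assms)

text \<open>The continuous functions \<open>f n\<close> decrease to the indicator of
  \<open>C\<close>, and trigonometric polynomials within \<open>1 / (n + 1)\<close> of them have the
  same pointwise limit on the torus.\<close>

lemma closed_class_indicator_closed:
  fixes C :: "(complex ^ 'n) set"
  assumes V: "closed_class torus V" "\<And>k. (\<lambda>z. charz z k) \<in> V" and C: "closed C"
  shows "indicator (torus \<inter> C) \<in> V"
\<comment> \<open>By convention \<open>infdist\<close> to the empty set is 0, so \<open>f n\<close>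
  would be constantly 1; the empty set is treated apart.\<close>
proof (cases "C = {}")
  case True
  have "(\<lambda>z :: complex ^ 'n. 0) \<in> V" using closed_class_scale[OF V(1) V(2)[of 0], of 0] by simp
  moreover have "indicator (torus \<inter> C) = (\<lambda>z :: complex ^ 'n. 0 :: complex)" using True by (auto simp: indicator_def)
  ultimately show ?thesis by simp
next
  case False
  define f where "f n z = max 0 (1 - real n * infdist z C)" for n and z :: "complex ^ 'n"
  have "\<exists>p\<in>trig. \<forall>z\<in>torus. cmod (p z - complex_of_real (f n z)) < 1 / real (Suc n)" for n
  proof -
    have "continuous_on torus (f n)" unfolding f_def by (intro continuous_intros)
    then show ?thesis using trig_approx[of "f n" "1 / real (Suc n)"] by (metis of_nat_0_less_iff zero_less_Suc zero_less_divide_1_iff)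
  qed
  then obtain p where p: "\<And>n. p n \<in> trig"
    "\<And>n z. z \<in> torus \<Longrightarrow> cmod (p n z - complex_of_real (f n z)) < 1 / real (Suc n)" by metis
  have f01: "0 \<le> f n z" "f n z \<le> 1" for n z by (auto simp: f_def infdist_nonneg)
  have fl: "(\<lambda>n. f n z) \<longlonglongrightarrow> indicator C z" for z
  proof (cases "z \<in> C")
    case True
    then show ?thesis by (simp add: f_def)
  next
    case out: False
    have pos: "infdist z C > 0"
      using out C False infdist_nonneg[of z C] in_closed_iff_infdist_zero by fastforce
    obtain N where N: "1 / infdist z C < real N" using reals_Archimedean2 by blast
    have "f n z = 0" if "n \<ge> N" for n
    proof -
      have "1 < real N * infdist z C" using N pos by (simp add: field_simps)
      also have "\<dots> \<le> real n * infdist z C" using that pos by (intro mult_right_mono) auto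
      finally show ?thesis by (simp add: f_def)
    qed
    then have "\<forall>\<^sub>F n in sequentially. f n z = indicator C z"
      using out by (auto simp: eventually_sequentially)
    then show ?thesis by (rule tendsto_eventually)
  qed
  show ?thesis
  \<comment> \<open>The bound 2 is the bound 1 for \<open>f n\<close> plus an approximation error
    below 1.\<close>
  proof (rule closed_class_lim[OF V(1), of p 2])
    show "p n \<in> V" for n by (rule closed_class_trig[OF V p(1)])
    show "cmod (p n z) \<le> 2" if z: "z \<in> torus" for n z
    proof -
      have "cmod (p n z) \<le> cmod (p n z - complex_of_real (f n z)) + cmod (complex_of_real (f n z))"
        by (metis norm_triangle_sub add.commute)
      moreover have "cmod (p n z - complex_of_real (f n z)) < 1"
        using p(2)[OF z, of n] by (rule less_le_trans) simp
      ultimately show ?thesis using f01[of n z] by simp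
    qed
    show "(\<lambda>n. p n z) \<longlonglongrightarrow> indicator (torus \<inter> C) z" if z: "z \<in> torus" for z
    proof -
      have "(\<lambda>n. p n z - complex_of_real (f n z)) \<longlonglongrightarrow> 0"
      proof (rule Lim_null_comparison)
        show "\<forall>\<^sub>F n in sequentially. cmod (p n z - complex_of_real (f n z)) \<le> 1 / real (Suc n)"
          using p(2)[OF z] by (auto intro!: always_eventually less_imp_le)
        show "(\<lambda>n. 1 / real (Suc n)) \<longlonglongrightarrow> 0"
          using LIMSEQ_inverse_real_of_nat by (simp add: inverse_eq_divide)
      qed
      from tendsto_add[OF this tendsto_of_real[OF fl[of z]]] z show ?thesis
        by (cases "z \<in> C") simp_all
    qed
  qed
qed

section \<open>Measures on the torus and their Fourier coefficients\<close>

lemma torus_prob_space: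
  assumes "torus_prob \<mu>" shows "space \<mu> = torus"
proof -
  have "sets \<mu> = sets (restrict_space borel torus)" using assms by (simp add: torus_prob_def)
  from sets_eq_imp_space_eq[OF this] show ?thesis by (simp add: space_restrict_space)
qed

lemma torus_prob_measurableI:
  assumes "torus_prob \<mu>" "f \<in> measurable borel N" shows "f \<in> measurable \<mu> N"
proof -
  have "sets \<mu> = sets (restrict_space borel torus)" using assms(1) by (simp add: torus_prob_def)
  then show ?thesis
    by (subst measurable_cong_sets[OF _ refl]) (assumption, rule measurable_restrict_space1[OF assms(2)])
qed

text \<open>Traces of closed sets on the torus are stable under intersection and generate the
  sigma-algebra, and their indicators are bounded limits of trigonometric polynomials.\<close>

lemma total_family_charz:
  fixes \<mu> :: "(complex ^ 'n) measure"
  assumes \<mu>: "torus_prob \<mu>"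
  shows "total_family \<mu> (range (\<lambda>k z. charz z k))"
  unfolding total_family_def
proof (intro allI impI)
  fix V assume V: "closed_class (space \<mu>) V" and sub: "range (\<lambda>k z. charz z k) \<subseteq> V"
  have sp: "space \<mu> = torus" by (rule torus_prob_space[OF \<mu>])
  let ?G = "(\<inter>) torus ` {C :: (complex ^ 'n) set. closed C}"
  show "bfun \<mu> \<subseteq> V"
  proof (rule total_family_generator[OF V])
    have "torus \<inter> C \<inter> (torus \<inter> D) = torus \<inter> (C \<inter> D)" for C D :: "(complex ^ 'n) set" by blast
    then show "Int_stable ?G" by (auto simp: Int_stable_def intro!: imageI closed_Int)
    show "?G \<subseteq> Pow (space \<mu>)" by (auto simp: sp)
    have "sets \<mu> = (\<inter>) torus ` sigma_sets UNIV {C :: (complex ^ 'n) set. closed C}"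
      using \<mu> unfolding torus_prob_def by (simp add: sets_restrict_space borel_eq_closed)
    \<comment> \<open>The torus is closed, hence Borel, so restriction to it commutes with
      generating the sigma-algebra.\<close>
    also have "\<dots> = sigma_sets torus ?G"
      using closed_torus by (intro sigma_sets_Int) auto
    finally show "sets \<mu> = sigma_sets (space \<mu>) ?G" by (simp add: sp)
    have "(\<lambda>z. charz z 0) \<in> V" using sub by blast
    then show "(\<lambda>z. 1) \<in> V" by simp
    fix S assume "S \<in> ?G"
    then obtain C where S: "S = torus \<inter> C" and C: "closed C" by auto
    show "indicator S \<in> V"
      unfolding S by (rule closed_class_indicator_closed[OF V[unfolded sp] _ C]) (use sub in auto)
  qed
qed

lemma charz_bfun:
  assumes \<mu>: "torus_prob \<mu>" shows "(\<lambda>z. charz z k) \<in> bfun \<mu>"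
proof (rule bfunI)
  show "(\<lambda>z. charz z k) \<in> borel_measurable \<mu>" by (rule torus_prob_measurableI[OF \<mu> borel_measurable_charz])
  show "cmod (charz z k) \<le> 1" if "z \<in> space \<mu>" for z
    using that by (simp add: torus_prob_space[OF \<mu>] norm_charz)
qed

lemma times_map_measurable:
  fixes \<mu> :: "(complex ^ 'n) measure"
  assumes \<mu>: "torus_prob \<mu>" shows "times_map A \<in> measurable \<mu> \<mu>"
proof -
  have "times_map A \<in> space \<mu> \<rightarrow> torus" by (auto simp: torus_prob_space[OF \<mu>] times_map_torus)
  then have "times_map A \<in> measurable \<mu> (restrict_space borel torus)"
    by (rule measurable_restrict_space2) (rule torus_prob_measurableI[OF \<mu> borel_measurable_times_map])
  moreover have "sets \<mu> = sets (restrict_space borel torus)" using \<mu> by (simp add: torus_prob_def)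
  ultimately show ?thesis using measurable_cong_sets[OF refl, of \<mu> "restrict_space borel torus" \<mu>] by simp
qed

text \<open>It allows invariance of a measure to be tested on a total family.\<close>

lemma (in finite_measure) closed_class_integral_eq:
  assumes [measurable]: "T \<in> measurable M M"
  shows "closed_class (space M) {f \<in> bfun M. (\<integral>x. f (T x) \<partial>M) = (\<integral>x. f x \<partial>M)}"
proof (rule closed_classI, goal_cases)
  case (1 f c)
  then show ?case by auto
next
  case (2 f g)
  have "integrable M f" "integrable M g" "integrable M (\<lambda>x. f (T x))" "integrable M (\<lambda>x. g (T x))"
    using 2 by (auto intro!: bfun_integrable intro: bfun_compose[OF _ assms])
  then show ?case using 2 by auto
next
  case (3 u f B)
  have u: "u n \<in> bfun M" "u n \<in> borel_measurable M" for n using 3(1) by (auto dest: bfun_measurable)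
  have uT: "(\<lambda>x. u n (T x)) \<in> bfun M" for n by (rule bfun_compose[OF u(1) assms])
  have f: "f \<in> bfun M" and 1: "(\<lambda>n. \<integral>x. u n x \<partial>M) \<longlonglongrightarrow> (\<integral>x. f x \<partial>M)"
    using bfun_dominated_convergence[of u B f] u(1) 3(2,3) by blast+
  have "(\<lambda>n. \<integral>x. u n (T x) \<partial>M) \<longlonglongrightarrow> (\<integral>x. f (T x) \<partial>M)"
    by (rule bfun_dominated_convergence(2)[where B=B, OF uT]) (use 3(2,3) measurable_space[OF assms] in auto)
  then have "(\<lambda>n. \<integral>x. u n x \<partial>M) \<longlonglongrightarrow> (\<integral>x. f (T x) \<partial>M)" using 3(1) by simp
  then have "(\<integral>x. f (T x) \<partial>M) = (\<integral>x. f x \<partial>M)" using 1 by (rule LIMSEQ_unique)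
  then show ?case using f by simp
qed

text \<open>A character composed with the map has integral
  \<open>fourier_coeff \<mu> (A *v k)\<close>. Agreement on characters extends to indicators by
  totality, which is uniqueness of Fourier coefficients.\<close>

lemma invariant_measureI:
  assumes \<mu>: "torus_prob \<mu>" and inv: "\<And>k. fourier_coeff \<mu> (A *v k) = fourier_coeff \<mu> k"
  shows "invariant_measure \<mu> (times_map A)"
proof -
  interpret prob_space \<mu> using \<mu> by (simp add: torus_prob_def)
  note T [measurable] = times_map_measurable[OF \<mu>, of A]
  have "(\<integral>z. charz (times_map A z) k \<partial>\<mu>) = (\<integral>z. charz z k \<partial>\<mu>)" for k
  proof -
    have "(\<integral>z. charz (times_map A z) k \<partial>\<mu>) = fourier_coeff \<mu> (A *v k)"
      unfolding fourier_coeff_def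
      by (intro Bochner_Integration.integral_cong) (auto simp: torus_prob_space[OF \<mu>] charz_times_map)
    then show ?thesis using inv by (simp add: fourier_coeff_def)
  qed
  then have eq: "f \<in> {f \<in> bfun \<mu>. (\<integral>x. f (times_map A x) \<partial>\<mu>) = (\<integral>x. f x \<partial>\<mu>)}" if "f \<in> bfun \<mu>" for f
    by (intro total_familyD[OF total_family_charz[OF \<mu>] closed_class_integral_eq[OF T] _ that])
       (auto intro: charz_bfun[OF \<mu>])
  have "distr \<mu> \<mu> (times_map A) = \<mu>"
  proof (rule measure_eqI)
    fix S assume "S \<in> sets (distr \<mu> \<mu> (times_map A))"
    then have S [measurable]: "S \<in> sets \<mu>" by simp
    have "complex_of_real (measure \<mu> (times_map A -` S \<inter> space \<mu>)) = (\<integral>x. indicator (times_map A -` S \<inter> space \<mu>) x \<partial>\<mu>)"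
      by (subst integral_indicator_complex) measurable
    also have "\<dots> = (\<integral>x. indicator S (times_map A x) \<partial>\<mu>)"
      by (intro Bochner_Integration.integral_cong) (auto simp: indicator_def)
    also have "\<dots> = complex_of_real (measure \<mu> S)" using eq[OF bfun_indicator[OF S]] integral_indicator_complex[OF S] by simp
    finally have "measure \<mu> (times_map A -` S \<inter> space \<mu>) = measure \<mu> S" by (simp only: of_real_eq_iff)
    then show "emeasure (distr \<mu> \<mu> (times_map A)) S = emeasure \<mu> S"
      by (simp add: emeasure_distr emeasure_eq_measure)
  qed simp
  then show ?thesis using T by (simp add: invariant_measure_def)
qed

lemma fourier_coeff_0: "torus_prob \<mu> \<Longrightarrow> fourier_coeff \<mu> 0 = 1"
  by (simp add: fourier_coeff_def torus_prob_def prob_space.prob_space)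

lemma norm_fourier_coeff_le:
  assumes \<mu>: "torus_prob \<mu>" shows "cmod (fourier_coeff \<mu> k) \<le> 1"
proof -
  interpret prob_space \<mu> using \<mu> by (simp add: torus_prob_def)
  have "cmod (fourier_coeff \<mu> k) \<le> (\<integral>z. cmod (charz z k) \<partial>\<mu>)"
    unfolding fourier_coeff_def by (rule integral_norm_bound)
  also have "\<dots> = (\<integral>z. 1 \<partial>\<mu>)"
    by (intro Bochner_Integration.integral_cong) (auto simp: torus_prob_space[OF \<mu>] norm_charz)
  finally show ?thesis by (simp add: prob_space)
qed

lemma mat_pow_Suc_vec: "mat_pow A (Suc j) *v k = mat_pow A j *v (A *v k)"
  by (simp add: matrix_vector_mul_assoc mat_pow_commute)

text \<open>With \<open>l = 0\<close> the limit reduces to \<open>fourier_coeff \<mu> k\<close>,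
  since the coefficient at 0 is 1. Passing from \<open>k\<close> to \<open>A *v k\<close> shifts the
  index \<open>j\<close> by one, which the Folner average absorbs.\<close>

lemma ave_invariant:
  assumes \<mu>: "torus_prob \<mu>" and F: "folner F"
    and lim: "\<And>k l. ave F (\<lambda>j. fourier_coeff \<mu> (mat_pow A j *v k + l)) \<longlonglongrightarrow> fourier_coeff \<mu> k * fourier_coeff \<mu> l"
  shows "invariant_measure \<mu> (times_map A)"
proof (rule invariant_measureI[OF \<mu>])
  fix k
  let ?b = "\<lambda>j. fourier_coeff \<mu> (mat_pow A j *v k)"
  have 1: "ave F ?b \<longlonglongrightarrow> fourier_coeff \<mu> k"
    using lim[of k 0] by (simp add: fourier_coeff_0[OF \<mu>])
  have 2: "ave F (\<lambda>j. ?b (Suc j)) \<longlonglongrightarrow> fourier_coeff \<mu> (A *v k)"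
    using lim[of "A *v k" 0] unfolding mat_pow_Suc_vec by (simp add: fourier_coeff_0[OF \<mu>])
  have "ave F (\<lambda>j. ?b j - ?b (Suc j)) \<longlonglongrightarrow> 0"
    by (rule folner_shift[OF F norm_fourier_coeff_le[OF \<mu>]])
  moreover have "ave F (\<lambda>j. ?b j - ?b (Suc j)) \<longlonglongrightarrow> fourier_coeff \<mu> k - fourier_coeff \<mu> (A *v k)"
    unfolding ave_diff by (rule tendsto_diff[OF 1 2])
  ultimately show "fourier_coeff \<mu> (A *v k) = fourier_coeff \<mu> k"
    using LIMSEQ_unique by fastforce
qed

section \<open>Invariant measures on the torus as measure-preserving systems\<close>

locale torus_system =
  fixes A :: "int ^ 'n ^ 'n" and \<mu> :: "(complex ^ 'n) measure"
  assumes \<mu>: "torus_prob \<mu>" and inv: "invariant_measure \<mu> (times_map A)"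
begin

sublocale mp_system \<mu> "times_map A"
proof -
  interpret prob_space \<mu> using \<mu> by (simp add: torus_prob_def)
  show "mp_system \<mu> (times_map A)"
    using inv by unfold_locales (auto simp: invariant_measure_def)
qed

lemma corr_charz:
  "corr (\<lambda>z. charz z k) (\<lambda>z. charz z l) = (\<lambda>j. fourier_coeff \<mu> (mat_pow A j *v k + l))"
  unfolding corr_def fourier_coeff_def fun_eq_iff
  by (auto intro!: Bochner_Integration.integral_cong simp: torus_prob_space[OF \<mu>] charz_funpow charz_add)

lemma mixes_charz:
  "mixes F (\<lambda>z. charz z k) (\<lambda>z. charz z l) \<longleftrightarrow>
    ave F (\<lambda>j. fourier_coeff \<mu> (mat_pow A j *v k + l)) \<longlonglongrightarrow> fourier_coeff \<mu> k * fourier_coeff \<mu> l"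
  unfolding mixes_def corr_charz fourier_coeff_def ..

lemma mixes_all_iff:
  "(\<forall>f\<in>bfun \<mu>. \<forall>q\<in>bfun \<mu>. mixes F f q) \<longleftrightarrow>
    (\<forall>k l. ave F (\<lambda>j. fourier_coeff \<mu> (mat_pow A j *v k + l)) \<longlonglongrightarrow> fourier_coeff \<mu> k * fourier_coeff \<mu> l)"
proof
  assume mix: "\<forall>f\<in>bfun \<mu>. \<forall>q\<in>bfun \<mu>. mixes F f q"
  show "\<forall>k l. ave F (\<lambda>j. fourier_coeff \<mu> (mat_pow A j *v k + l)) \<longlonglongrightarrow> fourier_coeff \<mu> k * fourier_coeff \<mu> l"
    unfolding mixes_charz[symmetric] by (intro allI mix[THEN bspec, THEN bspec] charz_bfun \<mu>)
next
  assume lim: "\<forall>k l. ave F (\<lambda>j. fourier_coeff \<mu> (mat_pow A j *v k + l)) \<longlonglongrightarrow> fourier_coeff \<mu> k * fourier_coeff \<mu> l"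
  show "\<forall>f\<in>bfun \<mu>. \<forall>q\<in>bfun \<mu>. mixes F f q"
  proof (intro ballI)
    fix f q assume fq: "f \<in> bfun \<mu>" "q \<in> bfun \<mu>"
    show "mixes F f q"
      by (rule mixes_total[OF total_family_charz[OF \<mu>] _ _ fq])
         (use lim in \<open>auto simp: mixes_charz charz_bfun[OF \<mu>]\<close>)
  qed
qed

text \<open>The mean ergodic theorem in one direction, indicators of invariant sets in the
  other.\<close>

lemma ergodic_iff:
  assumes F: "folner F"
  shows "ergodic_measure \<mu> (times_map A) \<longleftrightarrow> (\<forall>f\<in>bfun \<mu>. \<forall>q\<in>bfun \<mu>. mixes F f q)"
proof
  assume "ergodic_measure \<mu> (times_map A)"
  then show "\<forall>f\<in>bfun \<mu>. \<forall>q\<in>bfun \<mu>. mixes F f q" by (intro ballI mean_ergodic F)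
next
  assume "\<forall>f\<in>bfun \<mu>. \<forall>q\<in>bfun \<mu>. mixes F f q"
  then show "ergodic_measure \<mu> (times_map A)"
    by (intro mixes_imp_ergodic[OF folner_eventually[OF F]]) simp
qed

lemma weakly_mixing_iff:
  assumes F: "folner F"
  shows "weakly_mixing \<mu> (times_map A) \<longleftrightarrow>
    (\<forall>k l. ave F (\<lambda>j. (cmod (fourier_coeff \<mu> (mat_pow A j *v k + l) - fourier_coeff \<mu> k * fourier_coeff \<mu> l))\<^sup>2) \<longlonglongrightarrow> 0)"
  (is "_ \<longleftrightarrow> (\<forall>k l. ?lim k l)")
proof -
  have eq: "?lim k l \<longleftrightarrow> ave F (\<lambda>j. (cmod (corr (\<lambda>z. charz z k) (\<lambda>z. charz z l) j
      - (\<integral>z. charz z k \<partial>\<mu>) * (\<integral>z. charz z l \<partial>\<mu>)))\<^sup>2) \<longlonglongrightarrow> 0" for k l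
    unfolding corr_charz fourier_coeff_def ..
  show ?thesis
  proof
    assume "weakly_mixing \<mu> (times_map A)"
    then show "\<forall>k l. ?lim k l"
      unfolding eq by (intro allI weakly_mixing_corr F charz_bfun \<mu>)
  next
    assume "\<forall>k l. ?lim k l"
    then show "weakly_mixing \<mu> (times_map A)"
      unfolding eq by (intro weakly_mixingI[OF F total_family_charz[OF \<mu>]]) (auto intro: charz_bfun[OF \<mu>])
  qed
qed

end

theorem theorem4p1:
  fixes A :: "int ^ 'n ^ 'n" and F :: "nat \<Rightarrow> nat set" and \<mu> :: "(complex ^ 'n) measure"
  assumes "folner F" and "torus_prob \<mu>"
  shows "((invariant_measure \<mu> (times_map A) \<and> ergodic_measure \<mu> (times_map A)) \<longleftrightarrow>
           (\<forall>k l. (\<lambda>m. (\<Sum>j\<in>F m. fourier_coeff \<mu> (mat_pow A j *v k + l)) / of_nat (card (F m)))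
                    \<longlonglongrightarrow> fourier_coeff \<mu> k * fourier_coeff \<mu> l)) \<and>
         ((invariant_measure \<mu> (times_map A) \<and> weakly_mixing \<mu> (times_map A)) \<longleftrightarrow>
           (\<forall>k l. (\<lambda>m. (\<Sum>j\<in>F m. (cmod (fourier_coeff \<mu> (mat_pow A j *v k + l)
                                    - fourier_coeff \<mu> k * fourier_coeff \<mu> l))\<^sup>2) / real (card (F m)))
                    \<longlonglongrightarrow> 0)) \<and>
         ((invariant_measure \<mu> (times_map A) \<and> strongly_mixing \<mu> (times_map A)) \<longleftrightarrow>
           (\<forall>k l. (\<lambda>j. fourier_coeff \<mu> (mat_pow A j *v k + l))
                    \<longlonglongrightarrow> fourier_coeff \<mu> k * fourier_coeff \<mu> l))"
  (is "(?I \<and> ?E \<longleftrightarrow> ?L1) \<and> (?I \<and> ?W \<longleftrightarrow> ?L2) \<and> (?I \<and> ?S \<longleftrightarrow> ?L3)")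
proof -
  let ?c = "\<lambda>k l. fourier_coeff \<mu> k * fourier_coeff \<mu> l"
  let ?b = "\<lambda>k l j. fourier_coeff \<mu> (mat_pow A j *v k + l)"
  have L1: "?L1 \<longleftrightarrow> (\<forall>k l. ave F (?b k l) \<longlonglongrightarrow> ?c k l)" by (simp add: ave_def[abs_def])
  have L2: "?L2 \<longleftrightarrow> (\<forall>k l. ave F (\<lambda>j. (cmod (?b k l j - ?c k l))\<^sup>2) \<longlonglongrightarrow> 0)" by (simp add: ave_def[abs_def])
  \<comment> \<open>Each limit condition yields invariance on its own, so that afterwards all three
    equivalences can be proved inside one system.\<close>
  have i1: "?I" if ?L1
    using that unfolding L1 by (intro ave_invariant[OF assms(2,1)]) simp
  \<comment> \<open>By Cauchy-Schwarz the quadratic condition implies convergence of the plain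
    averages, which reduces this case to the previous one.\<close>
  have i2: "?I" if ?L2
  proof (rule ave_invariant[OF assms(2,1)])
    fix k l
    have "ave F (\<lambda>j. cmod (?b k l j - ?c k l)) \<longlonglongrightarrow> 0"
      using that unfolding L2 by (intro ave_norm_tendsto_0) blast
    then show "ave F (?b k l) \<longlonglongrightarrow> ?c k l" by (rule ave_tendstoI[OF assms(1)]) simp
  qed
  \<comment> \<open>Ordinary limits replace averages here: a convergent sequence and its shift by
    one index have the same limit.\<close>
  have i3: "?I" if ?L3
  proof (rule invariant_measureI[OF assms(2)])
    fix k
    have "(\<lambda>j. fourier_coeff \<mu> (mat_pow A j *v k)) \<longlonglongrightarrow> fourier_coeff \<mu> k"
      using that[rule_format, of k 0] by (simp add: fourier_coeff_0[OF assms(2)])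
    then have "(\<lambda>j. fourier_coeff \<mu> (mat_pow A (Suc j) *v k)) \<longlonglongrightarrow> fourier_coeff \<mu> k" by (rule LIMSEQ_Suc)
    moreover have "(\<lambda>j. fourier_coeff \<mu> (mat_pow A (Suc j) *v k)) \<longlonglongrightarrow> fourier_coeff \<mu> (A *v k)"
      using that[rule_format, of "A *v k" 0] unfolding mat_pow_Suc_vec by (simp add: fourier_coeff_0[OF assms(2)])
    ultimately show "fourier_coeff \<mu> (A *v k) = fourier_coeff \<mu> k" by (rule LIMSEQ_unique[symmetric])
  qed
  have sys: "(?E \<longleftrightarrow> ?L1) \<and> (?W \<longleftrightarrow> ?L2) \<and> (?S \<longleftrightarrow> ?L3)" if ?I
  proof -
    interpret torus_system A \<mu> using assms(2) that by unfold_locales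
    show ?thesis
      unfolding L1 L2 ergodic_iff[OF assms(1)] weakly_mixing_iff[OF assms(1)] strongly_mixing_iff mixes_all_iff
        ave_singleton by simp
  qed
  show ?thesis using i1 i2 i3 sys by blast
qed

end
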